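(* Let $(X,\xi)$ be a pointed coarse space in $\mathscr{C}$. The map $\omega'_{(X,\xi)}\colon\varepsilon(X,\xi)\to\iota(X,\xi)$ defined by $$\omega'_{(X,\xi)}[s]_{\equiv^{\varepsilon}_{X,\xi}}:=[{}^{*}s(i)]_{\equiv^{\iota}_{X,\xi}},\qquad i\in{}^{*}\mathbb{N}\setminus\mathbb{N},$$ is well-defined (i.e. independent of the choice of the representative $s\in S(X,\xi)$ and of the infinite index $i$), injective, and natural in $(X,\xi)$ (i.e. for every basepoint-preserving coarse map $f\colon(X,\xi)\to(Y,\eta)$ in $\mathscr{C}$ one has $\iota f\circ\omega'_{(X,\xi)}=\omega'_{(Y,\eta)}\circ\varepsilon f$).
   Context: A coarse structure on a set $X$ is an ideal $\mathcal{C}_X$ of the poset $(\mathcal{P}(X\times X),\subseteq)$ containing the diagonal and closed under composition $E\circ F=\{(x,y)\mid \exists z\in X,\ (x,z)\in E,\ (z,y)\in F\}$ and inversion; its elements are called controlled sets. A coarse space is a set with a coarse structure. $B\subseteq X$ is bounded if $B\times B\in\mathcal{C}_X$. A map between coarse spaces is proper if preimages of bounded sets are bounded, bornologous if $(f\times f)(E)$ is controlled for each controlled $E$, and coarse if proper and bornologous. $\mathbf{Coarse}_*$ is the category of pointed coarse spaces and basepoint-preserving coarse maps. A coarse sequence in $(X,\xi)$ is a coarse map $s\colon(\mathbb{N},0)\to(X,\xi)$, where $\mathbb{N}$ has the coarse structure consisting of sets on which $|i-j|$ is bounded. $S(X,\xi)$ is the set of coarse sequences in $(X,\xi)$. $\varepsilon$: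 for $E\in\mathcal{C}_X$, a set $A\subseteq X$ is $E$-connected if any $x,y\in A$ are joined by a finite sequence $x=x_0,\dots,x_n=y$ in $A$ with $(x_i,x_{i+1})\in E$ for all $i<n$ (an $E$-chain). For $s,t\in S(X,\xi)$, $s\equiv^{\varepsilon}_{X,\xi}t$ if there is $E\in\mathcal{C}_X$ such that for every bounded $B\subseteq X$ with $\xi\in B$ there is $N\in\mathbb{N}$ such that $\{s(i)\}_{i\ge N}$ and $\{t(i)\}_{i\ge N}$ are contained in the same $E$-connected component of $X\setminus B$. Put $\varepsilon(X,\xi):=S(X,\xi)/{\equiv^{\varepsilon}_{X,\xi}}$ and $\varepsilon f[s]:=[f\circ s]$ for morphisms $f$ of $\mathbf{Coarse}_*$; this is a functor to sets. Nonstandard setting: $\mathscr{C}$ is a fixed small full subcategory of $\mathbf{Coarse}_*$; $\mathbb{U}$ (the standard universe) is a transitive set containing $\mathscr{C}$ and all classical objects needed, with respect to which the needed set-theoretic formulae are absolute; ${}^{*}\colon\mathbb{U}\hookrightarrow{}^{*}\mathbb{U}$, $x\mapsto{}^{*}x$, is a fixed sufficiently saturated elementary extension (families of internal sets indexed by a set in $\mathbb{U}$ and having the finite intersection property have nonempty intersection). Points $x$ of a standard space are identified with ${}^{*}x$. "Standard" means belonging to $\mathbb{U}$. $\iota$: for a standard coarse space $X$ and $x,y\in{}^{*}X$, $x\sim_X y$ iff $(x,y)\in{}^{*}E$ for some (standard) $E\in\mathcal{C}_X$. $\operatorname{INF}(X,\xi):=\{x\in{}^{*}X\mid x\not\sim_X\xi\}$.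 For $x,y\in\operatorname{INF}(X,\xi)$, $x\equiv^{\iota}_{X,\xi}y$ if there is an internal hyperfinite sequence $\{x_i\}_{i\le n}$ ($n\in{}^{*}\mathbb{N}$) in $\operatorname{INF}(X,\xi)$ with $x_0=x$, $x_n=y$ and $x_i\sim_X x_{i+1}$ for all $i<n$. Put $\iota(X,\xi):=\operatorname{INF}(X,\xi)/{\equiv^{\iota}_{X,\xi}}$ and $\iota f[x]:=[{}^{*}f(x)]$ for morphisms $f$ of $\mathscr{C}$; this is a functor from $\mathscr{C}$ to sets. *)

theory Defs
  imports "HOL-Library.FuncSet"
begin

section \<open>Pointed coarse spaces\<close>

record 'a pcoarse =
  pts :: "'a set"
  ctrl :: "('a \<times> 'a) set set"
  base :: 'a

definition pointed_coarse_space :: "'a pcoarse \<Rightarrow> bool" where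
  "pointed_coarse_space X \<longleftrightarrow>
     base X \<in> pts X \<and>
     ctrl X \<subseteq> Pow (pts X \<times> pts X) \<and>
     (\<forall>E\<in>ctrl X. \<forall>F\<subseteq>E. F \<in> ctrl X) \<and>
     (\<forall>E\<in>ctrl X. \<forall>F\<in>ctrl X. E \<union> F \<in> ctrl X) \<and>
     Id_on (pts X) \<in> ctrl X \<and>
     (\<forall>E\<in>ctrl X. \<forall>F\<in>ctrl X. E O F \<in> ctrl X) \<and>
     (\<forall>E\<in>ctrl X. E\<inverse> \<in> ctrl X)"

definition cbounded :: "'a pcoarse \<Rightarrow> 'a set \<Rightarrow> bool" where
  "cbounded X B \<longleftrightarrow> B \<subseteq> pts X \<and> B \<times> B \<in> ctrl X"

definition proper :: "'a pcoarse \<Rightarrow> 'b pcoarse \<Rightarrow> ('a \<Rightarrow> 'b) \<Rightarrow> bool" where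
  "proper X Y f \<longleftrightarrow> (\<forall>B. cbounded Y B \<longrightarrow> cbounded X {x \<in> pts X. f x \<in> B})"

definition bornologous :: "'a pcoarse \<Rightarrow> 'b pcoarse \<Rightarrow> ('a \<Rightarrow> 'b) \<Rightarrow> bool" where
  "bornologous X Y f \<longleftrightarrow> (\<forall>E\<in>ctrl X. map_prod f f ` E \<in> ctrl Y)"

text \<open>Only the values of \<open>f\<close> on \<open>pts X\<close> matter, here and in all uses below.\<close>

definition pointed_coarse_map :: "'a pcoarse \<Rightarrow> 'b pcoarse \<Rightarrow> ('a \<Rightarrow> 'b) \<Rightarrow> bool" where
  "pointed_coarse_map X Y f \<longleftrightarrow>
     f \<in> pts X \<rightarrow> pts Y \<and> f (base X) = base Y \<and> proper X Y f \<and> bornologous X Y f"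

definition nat_space :: "nat pcoarse" where
  "nat_space = \<lparr>pts = UNIV,
     ctrl = {E. \<exists>k. \<forall>(i, j)\<in>E. \<bar>int i - int j\<bar> \<le> k},
     base = 0\<rparr>"

definition coarse_seqs :: "'a pcoarse \<Rightarrow> (nat \<Rightarrow> 'a) set" where
  "coarse_seqs X = {s. pointed_coarse_map nat_space X s}"


section \<open>The functor \<open>\<epsilon>\<close>\<close>

definition E_chain :: "('a \<times> 'a) set \<Rightarrow> 'a set \<Rightarrow> 'a \<Rightarrow> 'a \<Rightarrow> bool" where
  "E_chain E A x y \<longleftrightarrow> (\<exists>(n::nat) c. c 0 = x \<and> c n = y \<and> (\<forall>i\<le>n. c i \<in> A) \<and>
     (\<forall>i<n. (c i, c (Suc i)) \<in> E))"

definition E_connected :: "('a \<times> 'a) set \<Rightarrow> 'a set \<Rightarrow> bool" where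
  "E_connected E A \<longleftrightarrow> (\<forall>x\<in>A. \<forall>y\<in>A. E_chain E A x y)"

definition E_component :: "('a \<times> 'a) set \<Rightarrow> 'a set \<Rightarrow> 'a set \<Rightarrow> bool" where
  "E_component E A K \<longleftrightarrow> K \<subseteq> A \<and> E_connected E K \<and>
     (\<forall>K'. K \<subseteq> K' \<and> K' \<subseteq> A \<and> E_connected E K' \<longrightarrow> K' = K)"

definition eps_rel :: "'a pcoarse \<Rightarrow> ((nat \<Rightarrow> 'a) \<times> (nat \<Rightarrow> 'a)) set" where
  "eps_rel X = {(s, t). s \<in> coarse_seqs X \<and> t \<in> coarse_seqs X \<and>
     (\<exists>E\<in>ctrl X. \<forall>B. cbounded X B \<and> base X \<in> B \<longrightarrow>
        (\<exists>N K. E_component E (pts X - B) K \<and> s ` {N..} \<subseteq> K \<and> t ` {N..} \<subseteq> K))}"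

definition eps :: "'a pcoarse \<Rightarrow> (nat \<Rightarrow> 'a) set set" where
  "eps X = coarse_seqs X // eps_rel X"

definition eps_map ::
    "'a pcoarse \<Rightarrow> 'b pcoarse \<Rightarrow> ('a \<Rightarrow> 'b) \<Rightarrow> (nat \<Rightarrow> 'a) set \<Rightarrow> (nat \<Rightarrow> 'b) set" where
  "eps_map X Y f c = the_elem ((\<lambda>s. eps_rel Y `` {f \<circ> s}) ` c)"


section \<open>Membership structures\<close>

text \<open>A structure for the language of set theory is a type with a binary relation \<open>M\<close>,
  where \<open>M x y\<close> stands for \<open>x \<in> y\<close>. Formulae have named variables.\<close>

datatype fm = Mem nat nat | Eq nat nat | Neg fm | Conj fm fm | Exi nat fm

primrec sat :: "('a \<Rightarrow> 'a \<Rightarrow> bool) \<Rightarrow> fm \<Rightarrow> (nat \<Rightarrow> 'a) \<Rightarrow> bool" where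
  "sat M (Mem i j) v \<longleftrightarrow> M (v i) (v j)"
| "sat M (Eq i j) v \<longleftrightarrow> v i = v j"
| "sat M (Neg \<phi>) v \<longleftrightarrow> \<not> sat M \<phi> v"
| "sat M (Conj \<phi> \<psi>) v \<longleftrightarrow> sat M \<phi> v \<and> sat M \<psi> v"
| "sat M (Exi i \<phi>) v \<longleftrightarrow> (\<exists>x. sat M \<phi> (v(i := x)))"

definition ext :: "('a \<Rightarrow> 'a \<Rightarrow> bool) \<Rightarrow> 'a \<Rightarrow> 'a set" where
  "ext M a = {x. M x a}"

definition is_upair :: "('a \<Rightarrow> 'a \<Rightarrow> bool) \<Rightarrow> 'a \<Rightarrow> 'a \<Rightarrow> 'a \<Rightarrow> bool" where
  "is_upair M p a b \<longleftrightarrow> ext M p = {a, b}"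

text \<open>Kuratowski pairs.\<close>

definition is_opair :: "('a \<Rightarrow> 'a \<Rightarrow> bool) \<Rightarrow> 'a \<Rightarrow> 'a \<Rightarrow> 'a \<Rightarrow> bool" where
  "is_opair M p a b \<longleftrightarrow> (\<exists>u v. is_upair M u a a \<and> is_upair M v a b \<and> is_upair M p u v)"

definition pairs_of :: "('a \<Rightarrow> 'a \<Rightarrow> bool) \<Rightarrow> ('a \<times> 'a) set \<Rightarrow> 'a set" where
  "pairs_of M R = {p. \<exists>(a, b)\<in>R. is_opair M p a b}"

definition rel_of :: "('a \<Rightarrow> 'a \<Rightarrow> bool) \<Rightarrow> 'a \<Rightarrow> ('a \<times> 'a) set" where
  "rel_of M r = {(a, b). \<exists>p. is_opair M p a b \<and> M p r}"

definition is_fun :: "('a \<Rightarrow> 'a \<Rightarrow> bool) \<Rightarrow> 'a \<Rightarrow> 'a set \<Rightarrow> bool" where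
  "is_fun M c D \<longleftrightarrow> ext M c \<subseteq> pairs_of M (D \<times> UNIV) \<and>
     (\<forall>x\<in>D. \<exists>!y. (x, y) \<in> rel_of M c)"

definition app :: "('a \<Rightarrow> 'a \<Rightarrow> bool) \<Rightarrow> 'a \<Rightarrow> 'a \<Rightarrow> 'a" where
  "app M c x = (THE y. (x, y) \<in> rel_of M c)"

text \<open>Natural numbers are von Neumann numerals, so \<open>M\<close> is also their strict order.\<close>

definition is_succ :: "('a \<Rightarrow> 'a \<Rightarrow> bool) \<Rightarrow> 'a \<Rightarrow> 'a \<Rightarrow> bool" where
  "is_succ M j i \<longleftrightarrow> ext M j = insert i (ext M i)"

definition succ :: "('a \<Rightarrow> 'a \<Rightarrow> bool) \<Rightarrow> 'a \<Rightarrow> 'a" where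
  "succ M i = (THE j. is_succ M j i)"

primrec is_num :: "('a \<Rightarrow> 'a \<Rightarrow> bool) \<Rightarrow> nat \<Rightarrow> 'a \<Rightarrow> bool" where
  "is_num M 0 x \<longleftrightarrow> ext M x = {}"
| "is_num M (Suc n) x \<longleftrightarrow> (\<exists>y. is_num M n y \<and> is_succ M x y)"

definition num :: "('a \<Rightarrow> 'a \<Rightarrow> bool) \<Rightarrow> nat \<Rightarrow> 'a" where
  "num M n = (THE x. is_num M n x)"

definition set_code :: "('a \<Rightarrow> 'a \<Rightarrow> bool) \<Rightarrow> 'a set \<Rightarrow> 'a" where
  "set_code M A = (THE a. ext M a = A)"

definition rel_code :: "('a \<Rightarrow> 'a \<Rightarrow> bool) \<Rightarrow> ('a \<times> 'a) set \<Rightarrow> 'a" where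
  "rel_code M R = set_code M (pairs_of M R)"


section \<open>The standard universe and its extension\<close>

text \<open>By Mostowski's theorem, transitive sets are, up to isomorphism, the extensional
  well-founded structures. The remaining conditions place the classical objects (sequences,
  controlled sets, morphisms, finite chains and sets of such) in the universe and make the
  relevant notions absolute. They hold in every \<open>V\<^sub>\<lambda>\<close> with \<open>\<lambda> > \<omega>\<close> a limit ordinal, and also
  in every \<open>H\<^sub>\<kappa>\<close> (sets hereditarily of cardinality less than \<open>\<kappa>\<close>) with \<open>\<kappa>\<close> uncountable and
  regular; closure under full power sets is not required.\<close>

locale standard_universe =
  fixes mem :: "'u \<Rightarrow> 'u \<Rightarrow> bool"
  assumes extensional: "ext mem a = ext mem b \<Longrightarrow> a = b"
    and well_founded: "wfP mem"
    and pairing: "\<exists>p. is_upair mem p a b"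
    and products: "\<exists>c. ext mem c = pairs_of mem (ext mem a \<times> ext mem b)"
    and all_subsets: "A \<subseteq> ext mem a \<Longrightarrow> \<exists>b. ext mem b = A"
    and finite_subsets: "\<exists>b. ext mem b = {x. finite (ext mem x) \<and> ext mem x \<subseteq> ext mem a}"
    and numerals: "\<exists>x. is_num mem n x"
    and omega: "\<exists>w. ext mem w = {x. \<exists>n. is_num mem n x}"

locale nonstandard_universe = standard_universe mem
  for mem :: "'u \<Rightarrow> 'u \<Rightarrow> bool" +
  fixes smem :: "'v \<Rightarrow> 'v \<Rightarrow> bool"
    and star :: "'u \<Rightarrow> 'v"
  assumes elementary: "sat mem \<phi> v \<longleftrightarrow> sat smem \<phi> (star \<circ> v)"
    and saturated: "(\<And>J. finite J \<Longrightarrow> J \<subseteq> ext mem I \<Longrightarrow> \<exists>y. \<forall>j\<in>J. y \<in> ext smem (F j))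
      \<Longrightarrow> \<exists>y. \<forall>j\<in>ext mem I. y \<in> ext smem (F j)"

text \<open>A full subcategory is given by its set of objects. As the universe is transitive, the
  points of a space in it are themselves elements of the universe; the basepoint and the
  controlled sets are then in the universe as well.\<close>

definition standard_category :: "('u \<Rightarrow> 'u \<Rightarrow> bool) \<Rightarrow> 'u pcoarse set \<Rightarrow> bool" where
  "standard_category mem C \<longleftrightarrow> (\<forall>X\<in>C. pointed_coarse_space X \<and>
     (\<exists>a. ext mem a = pts X) \<and> (\<exists>a. ext mem a = rel_code mem ` ctrl X))"

definition star_set ::
    "('u \<Rightarrow> 'u \<Rightarrow> bool) \<Rightarrow> ('v \<Rightarrow> 'v \<Rightarrow> bool) \<Rightarrow> ('u \<Rightarrow> 'v) \<Rightarrow> 'u set \<Rightarrow> 'v set" where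
  "star_set mem smem star A = ext smem (star (set_code mem A))"

definition star_rel ::
    "('u \<Rightarrow> 'u \<Rightarrow> bool) \<Rightarrow> ('v \<Rightarrow> 'v \<Rightarrow> bool) \<Rightarrow> ('u \<Rightarrow> 'v) \<Rightarrow> ('u \<times> 'u) set \<Rightarrow> ('v \<times> 'v) set" where
  "star_rel mem smem star R = rel_of smem (star (rel_code mem R))"

definition star_fun :: "('u \<Rightarrow> 'u \<Rightarrow> bool) \<Rightarrow> ('v \<Rightarrow> 'v \<Rightarrow> bool) \<Rightarrow> ('u \<Rightarrow> 'v) \<Rightarrow>
    'u set \<Rightarrow> ('u \<Rightarrow> 'u) \<Rightarrow> 'v \<Rightarrow> 'v" where
  "star_fun mem smem star A f = app smem (star (rel_code mem ((\<lambda>a. (a, f a)) ` A)))"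

definition star_seq :: "('u \<Rightarrow> 'u \<Rightarrow> bool) \<Rightarrow> ('v \<Rightarrow> 'v \<Rightarrow> bool) \<Rightarrow> ('u \<Rightarrow> 'v) \<Rightarrow>
    (nat \<Rightarrow> 'u) \<Rightarrow> 'v \<Rightarrow> 'v" where
  "star_seq mem smem star s = app smem (star (rel_code mem (range (\<lambda>n. (num mem n, s n)))))"

definition star_nat ::
    "('u \<Rightarrow> 'u \<Rightarrow> bool) \<Rightarrow> ('v \<Rightarrow> 'v \<Rightarrow> bool) \<Rightarrow> ('u \<Rightarrow> 'v) \<Rightarrow> 'v set" where
  "star_nat mem smem star = star_set mem smem star (range (num mem))"

definition infinite_nat ::
    "('u \<Rightarrow> 'u \<Rightarrow> bool) \<Rightarrow> ('v \<Rightarrow> 'v \<Rightarrow> bool) \<Rightarrow> ('u \<Rightarrow> 'v) \<Rightarrow> 'v set" where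
  "infinite_nat mem smem star = star_nat mem smem star - star ` range (num mem)"


section \<open>The functor \<open>\<iota>\<close> and the comparison map\<close>

definition sim :: "('u \<Rightarrow> 'u \<Rightarrow> bool) \<Rightarrow> ('v \<Rightarrow> 'v \<Rightarrow> bool) \<Rightarrow> ('u \<Rightarrow> 'v) \<Rightarrow>
    'u pcoarse \<Rightarrow> 'v \<Rightarrow> 'v \<Rightarrow> bool" where
  "sim mem smem star X x y \<longleftrightarrow> (\<exists>E\<in>ctrl X. (x, y) \<in> star_rel mem smem star E)"

definition inf_pts :: "('u \<Rightarrow> 'u \<Rightarrow> bool) \<Rightarrow> ('v \<Rightarrow> 'v \<Rightarrow> bool) \<Rightarrow> ('u \<Rightarrow> 'v) \<Rightarrow>
    'u pcoarse \<Rightarrow> 'v set" where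
  "inf_pts mem smem star X =
     {x \<in> star_set mem smem star (pts X). \<not> sim mem smem star X x (star (base X))}"

text \<open>An internal sequence \<open>(x\<^sub>i)\<close> with \<open>i \<le> n\<close> is an element \<open>c\<close> of the extension that is a
  function with domain \<open>{i. i \<le> n}\<close>; the order on hypernaturals is \<open>smem\<close>.\<close>

definition iota_rel :: "('u \<Rightarrow> 'u \<Rightarrow> bool) \<Rightarrow> ('v \<Rightarrow> 'v \<Rightarrow> bool) \<Rightarrow> ('u \<Rightarrow> 'v) \<Rightarrow>
    'u pcoarse \<Rightarrow> ('v \<times> 'v) set" where
  "iota_rel mem smem star X =
     {(x, y). x \<in> inf_pts mem smem star X \<and> y \<in> inf_pts mem smem star X \<and>
        (\<exists>n\<in>star_nat mem smem star. \<exists>c.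
           is_fun smem c {i \<in> star_nat mem smem star. smem i n \<or> i = n} \<and>
           (\<forall>i\<in>star_nat mem smem star. smem i n \<or> i = n \<longrightarrow>
              app smem c i \<in> inf_pts mem smem star X) \<and>
           app smem c (star (num mem 0)) = x \<and> app smem c n = y \<and>
           (\<forall>i\<in>star_nat mem smem star. smem i n \<longrightarrow>
              sim mem smem star X (app smem c i) (app smem c (succ smem i))))}"

definition iota :: "('u \<Rightarrow> 'u \<Rightarrow> bool) \<Rightarrow> ('v \<Rightarrow> 'v \<Rightarrow> bool) \<Rightarrow> ('u \<Rightarrow> 'v) \<Rightarrow>
    'u pcoarse \<Rightarrow> 'v set set" where
  "iota mem smem star X = inf_pts mem smem star X // iota_rel mem smem star X"

definition iota_map :: "('u \<Rightarrow> 'u \<Rightarrow> bool) \<Rightarrow> ('v \<Rightarrow> 'v \<Rightarrow> bool) \<Rightarrow> ('u \<Rightarrow> 'v) \<Rightarrow>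
    'u pcoarse \<Rightarrow> 'u pcoarse \<Rightarrow> ('u \<Rightarrow> 'u) \<Rightarrow> 'v set \<Rightarrow> 'v set" where
  "iota_map mem smem star X Y f k =
     the_elem ((\<lambda>x. iota_rel mem smem star Y `` {star_fun mem smem star (pts X) f x}) ` k)"

definition omega' :: "('u \<Rightarrow> 'u \<Rightarrow> bool) \<Rightarrow> ('v \<Rightarrow> 'v \<Rightarrow> bool) \<Rightarrow> ('u \<Rightarrow> 'v) \<Rightarrow>
    'u pcoarse \<Rightarrow> (nat \<Rightarrow> 'u) set \<Rightarrow> 'v set" where
  "omega' mem smem star X k = the_elem
     {iota_rel mem smem star X `` {star_seq mem smem star s i} | s i.
        s \<in> k \<and> i \<in> infinite_nat mem smem star}"

end

theory Submission
  imports Defs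
begin

text \<open>Call \<open>far_chains X E F\<close> the standard relation of being joined by an \<open>E\<close>-chain that avoids
  the ball \<open>{z. (z, \<xi>) \<in> F}\<close>. Then \<open>x \<equiv>\<^sup>\<iota> y\<close> holds iff for some standard \<open>E\<close> and all standard \<open>F\<close>
  the pair \<open>(x, y)\<close> lies in the star of \<open>far_chains X E F\<close>: saturation makes the controlled set
  of the single steps uniform along a hyperfinite chain and, conversely, merges the chains that
  avoid each standard ball into one that avoids them all. In the same way \<open>s \<equiv>\<^sup>\<epsilon> t\<close> says that for
  some \<open>E\<close> and all \<open>F\<close> the pairs \<open>(s i, t j)\<close> eventually lie in \<open>far_chains X E F\<close>. A
  statement about tails transfers to infinite indices; conversely a single infinite pair of
  indices yields arbitrarily large standard ones, which suffices because the tails of coarse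
  sequences are chains themselves.\<close>

section \<open>Structures\<close>

text \<open>Transfer only speaks of formulae with standard parameters. Apart from facts on
  hypernaturals and internal sets, it is therefore spent on two things: the star map on relations
  respects inclusion, composition and converse, and \<open>far_chains\<close> is definable through
  codes of chains. After that, most steps are inclusions between composites of standard relations,
  read off in the extension. So the equivalence laws never require concatenating or reversing
  hyperfinite sequences; this is done with finite chains before transfer. Saturation needs internal
  sets and an index set in the universe. The universe need not have power sets, so the internal set
  of chain codes is cut out of a set of finite sets of pairs. The index set consists of the codes of
  controlled sets; as these are closed under finite unions, finitely many conditions reduce to one.
  Bounded sets are traded for controlled ones: balls of controlled sets are bounded, and a bounded
  \<open>B\<close> containing the basepoint \<xi> is the ball of
  \<open>B \<times> {\<xi>}\<close>.\<close>

lemma is_opair_ext: "is_opair M p a b \<Longrightarrow> ext M ` ext M p = {{a}, {a, b}}"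
  unfolding is_opair_def is_upair_def by auto

text \<open>Applying \<open>ext\<close> twice turns a code into the Kuratowski pair of HOL sets,
  which determines its components. This works in any structure, so it serves \<open>mem\<close> and
  \<open>smem\<close> alike.\<close>

lemma is_opair_inject:
  assumes "is_opair M p a b" "is_opair M p c d"
  shows "a = c \<and> b = d"
proof -
  have "{{a}, {a, b}} = {{c}, {c, d}}"
    using is_opair_ext[OF assms(1), symmetric] is_opair_ext[OF assms(2)] by (rule trans)
  then show ?thesis by (auto simp: doubleton_eq_iff)
qed

lemma app_eqI: "is_fun M c D \<Longrightarrow> x \<in> D \<Longrightarrow> (x, y) \<in> rel_of M c \<Longrightarrow> app M c x = y"
  unfolding is_fun_def app_def by (blast intro: the1_equality)

lemma app_rel: "is_fun M c D \<Longrightarrow> x \<in> D \<Longrightarrow> (x, app M c x) \<in> rel_of M c"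
  unfolding is_fun_def app_def by (metis (no_types, lifting) theI')

lemma is_fun_ex: "is_fun M c D \<Longrightarrow> x \<in> D \<Longrightarrow> \<exists>p y. is_opair M p x y \<and> M p c"
  using app_rel[of M c D x] unfolding rel_of_def by auto

lemma is_fun_mem: "is_fun M c D \<Longrightarrow> M p c \<Longrightarrow> \<exists>x y. x \<in> D \<and> is_opair M p x y"
  unfolding is_fun_def ext_def pairs_of_def by fast

lemma is_fun_domain_subset:
  assumes "is_fun M c D" "is_fun M c D'"
  shows "D \<subseteq> D'"
proof
  fix x assume "x \<in> D"
  then obtain p y where p: "is_opair M p x y" "M p c"
    using is_fun_ex[OF assms(1)] by blast
  then obtain a b where "a \<in> D'" "is_opair M p a b"
    using is_fun_mem[OF assms(2)] by blast
  then show "x \<in> D'" using is_opair_inject[OF p(1)] by simp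
qed

text \<open>Lets the length of a hyperfinite chain be read off from its code, as in
  \<open>uniform_chain\<close>.\<close>

lemma is_fun_domain_unique: "is_fun M c D \<Longrightarrow> is_fun M c D' \<Longrightarrow> D = D'"
  by (simp add: is_fun_domain_subset subset_antisym)

abbreviation upto_num :: "('a \<Rightarrow> 'a \<Rightarrow> bool) \<Rightarrow> 'a \<Rightarrow> 'a \<Rightarrow> 'a set" where
  "upto_num M w n \<equiv> {i. M i w \<and> (M i n \<or> i = n)}"

text \<open>\<open>c\<close> codes an \<open>E\<close>-chain from \<open>x\<close> to \<open>y\<close> in \<open>A\<close>, indexed by the numerals up to \<open>n\<close>, that
  avoids \<open>{z. (z, b) \<in> F}\<close>. The set \<open>w\<close> of numerals is a parameter so that it can be interpreted
  by its star in the extension.\<close>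

definition is_chain ::
    "('a \<Rightarrow> 'a \<Rightarrow> bool) \<Rightarrow> 'a \<Rightarrow> 'a \<Rightarrow> 'a \<Rightarrow> 'a \<Rightarrow> 'a \<Rightarrow> 'a \<Rightarrow> 'a \<Rightarrow> 'a \<Rightarrow> 'a \<Rightarrow> bool" where
  "is_chain M w A E F b c n x y \<longleftrightarrow>
     M n w \<and> is_fun M c (upto_num M w n) \<and>
     (\<exists>z. ext M z = {} \<and> (z, x) \<in> rel_of M c) \<and> (n, y) \<in> rel_of M c \<and>
     (\<forall>i z. M i w \<and> (M i n \<or> i = n) \<and> (i, z) \<in> rel_of M c \<longrightarrow> M z A \<and> (z, b) \<notin> rel_of M F) \<and>
     (\<forall>i j u v. M i w \<and> M i n \<and> is_succ M j i \<and> (i, u) \<in> rel_of M c \<and> (j, v) \<in> rel_of M c \<longrightarrow>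
        (u, v) \<in> rel_of M E)"

text \<open>\<open>ext\<close>, set equality and unique existence live in HOL and match no formula
  constructor. This and the following equivalences rewrite the notions in \<open>is_chain\<close>
  into the shape that the transfer rules can decompose.\<close>

lemma is_upair_iff: "is_upair M p a b \<longleftrightarrow> (\<forall>x. M x p \<longleftrightarrow> x = a \<or> x = b)"
  unfolding is_upair_def ext_def by auto

lemma is_succ_iff: "is_succ M j i \<longleftrightarrow> (\<forall>x. M x j \<longleftrightarrow> x = i \<or> M x i)"
  unfolding is_succ_def ext_def by auto

lemma rel_of_iff: "(x, y) \<in> rel_of M r \<longleftrightarrow> (\<exists>p. is_opair M p x y \<and> M p r)"
  unfolding rel_of_def by simp

lemma is_fun_upto_num_iff:
  "is_fun M c (upto_num M w n) \<longleftrightarrow>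
    (\<forall>p. M p c \<longrightarrow> (\<exists>i. (M i w \<and> (M i n \<or> i = n)) \<and> (\<exists>y. is_opair M p i y))) \<and>
    (\<forall>i. M i w \<and> (M i n \<or> i = n) \<longrightarrow>
      (\<exists>y. (i, y) \<in> rel_of M c \<and> (\<forall>z. (i, z) \<in> rel_of M c \<longrightarrow> z = y)))"
  unfolding is_fun_def ext_def pairs_of_def Ex1_def by auto

lemma ext_empty_iff: "ext M z = {} \<longleftrightarrow> (\<forall>x. \<not> M x z)"
  unfolding ext_def by auto

text \<open>Avoiding a larger ball is the stronger condition, so a chain that avoids the ball of a
  union serves each part. This is the directedness that saturation uses.\<close>

lemma is_chain_mono:
  assumes ch: "is_chain M w A E F b c n x y"
    and "rel_of M E \<subseteq> rel_of M E'" "rel_of M F' \<subseteq> rel_of M F"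
  shows "is_chain M w A E' F' b c n x y"
proof -
  have "\<forall>i z. M i w \<and> (M i n \<or> i = n) \<and> (i, z) \<in> rel_of M c \<longrightarrow> M z A \<and> (z, b) \<notin> rel_of M F'"
    using ch assms(3) unfolding is_chain_def by blast
  moreover have "\<forall>i j u v. M i w \<and> M i n \<and> is_succ M j i \<and>
      (i, u) \<in> rel_of M c \<and> (j, v) \<in> rel_of M c \<longrightarrow> (u, v) \<in> rel_of M E'"
    using ch assms(2) unfolding is_chain_def by blast
  ultimately show ?thesis using ch unfolding is_chain_def by simp
qed

lemma is_chain_value:
  "is_chain M w A E F b c n x y \<Longrightarrow> M i w \<Longrightarrow> M i n \<or> i = n \<Longrightarrow> (i, z) \<in> rel_of M c \<Longrightarrow>
    M z A \<and> (z, b) \<notin> rel_of M F"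
  unfolding is_chain_def by blast

lemma is_chain_step:
  "is_chain M w A E F b c n x y \<Longrightarrow> M i w \<Longrightarrow> M i n \<Longrightarrow> is_succ M j i \<Longrightarrow>
    (i, u) \<in> rel_of M c \<Longrightarrow> (j, v) \<in> rel_of M c \<Longrightarrow> (u, v) \<in> rel_of M E"
  unfolding is_chain_def by blast

section \<open>Standard universes\<close>

context standard_universe
begin

definition is_set :: "'u set \<Rightarrow> bool" where
  "is_set A \<longleftrightarrow> (\<exists>a. ext mem a = A)"

text \<open>A bound by a product is what \<open>products\<close> and \<open>all_subsets\<close> turn
  into a code, and it passes to composites and converses.\<close>

definition is_rel :: "('u \<times> 'u) set \<Rightarrow> bool" where
  "is_rel R \<longleftrightarrow> (\<exists>A B. is_set A \<and> is_set B \<and> R \<subseteq> A \<times> B)"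

lemma ext_set_code: "is_set A \<Longrightarrow> ext mem (set_code mem A) = A"
proof -
  assume "is_set A"
  then obtain a where a: "ext mem a = A" unfolding is_set_def by blast
  show ?thesis unfolding set_code_def
    by (rule theI[of _ a], rule a) (rule extensional, simp add: a)
qed


lemma is_set_subset: "is_set B \<Longrightarrow> A \<subseteq> B \<Longrightarrow> is_set A"
  unfolding is_set_def using all_subsets by metis

lemma is_set_pair: "is_set {a, b}"
  using pairing unfolding is_set_def is_upair_def by metis

lemma is_set_singleton: "is_set {a}"
  using is_set_pair[of a a] by simp

lemma ex_opair: "\<exists>p. is_opair mem p a b"
  using pairing unfolding is_opair_def by metis

lemma opair_unique: "is_opair mem p a b \<Longrightarrow> is_opair mem q a b \<Longrightarrow> p = q"
  unfolding is_opair_def is_upair_def using extensional by metis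

lemma is_relI: "is_set A \<Longrightarrow> is_set B \<Longrightarrow> R \<subseteq> A \<times> B \<Longrightarrow> is_rel R"
  unfolding is_rel_def by blast

lemma is_rel_subset: "is_rel S \<Longrightarrow> R \<subseteq> S \<Longrightarrow> is_rel R"
  unfolding is_rel_def by blast

lemma is_rel_comp: "is_rel R \<Longrightarrow> is_rel S \<Longrightarrow> is_rel (R O S)"
proof -
  assume "is_rel R" "is_rel S"
  then obtain A B A' B' where "is_set A" "R \<subseteq> A \<times> B" "is_set B'" "S \<subseteq> A' \<times> B'"
    unfolding is_rel_def by auto
  then show ?thesis by (intro is_relI[of A B']) auto
qed

lemma is_rel_converse: "is_rel R \<Longrightarrow> is_rel (R\<inverse>)"
  unfolding is_rel_def by (metis converse_mono converse_Times)

lemma is_rel_Times: "is_set A \<Longrightarrow> is_set B \<Longrightarrow> is_rel (A \<times> B)"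
  unfolding is_rel_def by blast

lemma is_rel_Id_on: "is_set A \<Longrightarrow> is_rel (Id_on A)"
  by (rule is_relI[of A A]) auto

lemma is_set_pairs: "is_rel R \<Longrightarrow> is_set (pairs_of mem R)"
proof -
  assume "is_rel R"
  then obtain a b where "R \<subseteq> ext mem a \<times> ext mem b" unfolding is_rel_def is_set_def by blast
  then have "pairs_of mem R \<subseteq> pairs_of mem (ext mem a \<times> ext mem b)"
    unfolding pairs_of_def by blast
  then show ?thesis using products all_subsets unfolding is_set_def by metis
qed

lemma ext_rel_code: "is_rel R \<Longrightarrow> ext mem (rel_code mem R) = pairs_of mem R"
  unfolding rel_code_def by (simp add: ext_set_code is_set_pairs)

lemma mem_rel_code: "is_rel R \<Longrightarrow> mem p (rel_code mem R) \<longleftrightarrow> (\<exists>a b. (a, b) \<in> R \<and> is_opair mem p a b)"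
  using ext_rel_code unfolding ext_def pairs_of_def by blast

lemma rel_of_rel_code: "is_rel R \<Longrightarrow> rel_of mem (rel_code mem R) = R"
proof -
  assume R: "is_rel R"
  have "(a, b) \<in> rel_of mem (rel_code mem R) \<longleftrightarrow> (a, b) \<in> R" for a b
  proof
    assume "(a, b) \<in> rel_of mem (rel_code mem R)"
    then obtain p c d where p: "is_opair mem p a b" "(c, d) \<in> R" "is_opair mem p c d"
      unfolding rel_of_def by (auto simp: mem_rel_code[OF R])
    then show "(a, b) \<in> R" using is_opair_inject[OF p(1,3)] by simp
  next
    assume "(a, b) \<in> R"
    moreover obtain p where "is_opair mem p a b" using ex_opair by blast
    ultimately have "is_opair mem p a b \<and> mem p (rel_code mem R)"
      unfolding mem_rel_code[OF R] by blast
    then show "(a, b) \<in> rel_of mem (rel_code mem R)"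
      unfolding rel_of_def by blast
  qed
  then show ?thesis by auto
qed

lemma mem_set_code: "is_set A \<Longrightarrow> mem x (set_code mem A) \<longleftrightarrow> x \<in> A"
  using ext_set_code unfolding ext_def by blast

text \<open>\<open>all_subsets\<close> admits every HOL predicate \<open>P\<close>. When
  \<open>P\<close> is given by a formula, the instance transfers and supplies internal sets in the
  extension.\<close>

lemma separation: "\<exists>b. \<forall>x. mem x b \<longleftrightarrow> mem x a \<and> P x"
  using all_subsets[of "{x. mem x a \<and> P x}" a] unfolding ext_def by (auto simp: set_eq_iff)

section \<open>Standard numerals\<close>

lemma is_num_unique: "is_num mem n x \<Longrightarrow> is_num mem n y \<Longrightarrow> x = y"
proof (induction n arbitrary: x y)
  case 0 then show ?case by (simp add: extensional[of x y])
next
  case (Suc n)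
  then obtain x' y' where "is_num mem n x'" "is_succ mem x x'" "is_num mem n y'" "is_succ mem y y'"
    by auto
  then show ?case using Suc.IH[of x' y'] extensional[of x y] by (simp add: is_succ_def)
qed

lemma is_num_num: "is_num mem n (num mem n)"
proof -
  obtain x where x: "is_num mem n x" using numerals by blast
  show ?thesis unfolding num_def by (rule theI[of _ x], rule x) (rule is_num_unique[OF _ x])
qed

lemma num_eqI: "is_num mem n x \<Longrightarrow> num mem n = x"
  using is_num_num is_num_unique by blast

lemma is_succ_num: "is_succ mem (num mem (Suc n)) (num mem n)"
proof -
  obtain y where "is_num mem n y" "is_succ mem (num mem (Suc n)) y"
    using is_num_num[of "Suc n"] by auto
  then show ?thesis using num_eqI[of n y] by simp
qed

lemma ext_num_0: "ext mem (num mem 0) = {}"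
  using is_num_num[of 0] by simp

lemma ext_num: "ext mem (num mem n) = num mem ` {..<n}"
proof (induction n)
  case 0 show ?case by (simp add: ext_num_0)
next
  case (Suc n)
  then show ?case using is_succ_num[of n] unfolding is_succ_def by (simp add: lessThan_Suc)
qed

lemma mem_irrefl: "\<not> mem x x"
  using well_founded by (metis wfp_imp_irreflp irreflp_def wfp_def)

lemma mem_asym: "mem x y \<Longrightarrow> \<not> mem y x"
  using well_founded by (metis wfp_imp_asymp asympD)

lemma mem_num_iff: "mem (num mem i) (num mem j) \<longleftrightarrow> i < j"
proof
  have 1: "mem (num mem i) (num mem j)" if "i < j" for i j
  proof -
    have "num mem i \<in> ext mem (num mem j)" using that unfolding ext_num by blast
    then show ?thesis by (simp add: ext_def)
  qed
  show "i < j \<Longrightarrow> mem (num mem i) (num mem j)" by (rule 1)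
  assume "mem (num mem i) (num mem j)"
  then show "i < j" using 1[of j i] mem_asym mem_irrefl by (metis linorder_neqE_nat)
qed

lemma num_inject [simp]: "num mem i = num mem j \<longleftrightarrow> i = j"
  using mem_num_iff mem_irrefl by (metis linorder_neqE_nat)

lemma is_set_nums: "is_set (range (num mem))"
proof -
  obtain w where "ext mem w = {x. \<exists>n. is_num mem n x}" using omega by blast
  also have "{x. \<exists>n. is_num mem n x} = range (num mem)"
    using is_num_num num_eqI by fast
  finally show ?thesis unfolding is_set_def by blast
qed

definition nums :: 'u where
  "nums = set_code mem (range (num mem))"

lemma mem_nums: "mem x nums \<longleftrightarrow> x \<in> range (num mem)"
  unfolding nums_def by (simp add: mem_set_code is_set_nums)

lemma is_set_num_image: "is_set (num mem ` A)"
  by (rule is_set_subset[OF is_set_nums]) blast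

lemma upto_num_num: "upto_num mem nums (num mem n) = num mem ` {..n}"
  by (auto simp: mem_nums mem_num_iff less_imp_le le_less)

lemma is_succ_num_iff: "is_succ mem x (num mem n) \<longleftrightarrow> x = num mem (Suc n)"
  using is_succ_num extensional unfolding is_succ_def by metis

text \<open>The set \<open>K\<close> bounds the chain codes: its star supplies the ambient internal set
  in which saturation looks for a chain.\<close>

lemma chain_bound:
  assumes "is_set A"
  shows "\<exists>K. \<forall>E F b c n x y. is_chain mem nums (set_code mem A) E F b c n x y \<longrightarrow> mem c K"
proof -
  have rel: "is_rel (range (num mem) \<times> A)" using assms is_set_nums by (rule is_rel_Times[rotated])
  \<comment> \<open>Standard chains are finite, so the finite sets of pairs stand in for the power
    set of the product.\<close>
  obtain K where K: "ext mem K = {x. finite (ext mem x) \<and> ext mem x \<subseteq> pairs_of mem (range (num mem) \<times> A)}"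
    using finite_subsets[of "rel_code mem (range (num mem) \<times> A)"] by (auto simp: ext_rel_code[OF rel])
  have "mem c K" if ch: "is_chain mem nums (set_code mem A) E F b c n x y" for E F b c n x y
  proof -
    obtain m where n: "n = num mem m" using ch unfolding is_chain_def mem_nums by blast
    have f: "is_fun mem c (num mem ` {..m})"
      using ch unfolding is_chain_def n upto_num_num by blast
    have val: "z \<in> A" if "i \<in> num mem ` {..m}" "(i, z) \<in> rel_of mem c" for i z
      using ch that assms unfolding is_chain_def n upto_num_num[symmetric]
      by (auto simp: mem_set_code)
    have pr: "\<exists>i z. i \<in> num mem ` {..m} \<and> is_opair mem p i z \<and> (i, z) \<in> rel_of mem c"
      if "mem p c" for p
      using is_fun_mem[OF f that] that unfolding rel_of_def by auto
    have sub: "ext mem c \<subseteq> pairs_of mem (range (num mem) \<times> A)"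
      using pr val unfolding ext_def pairs_of_def by blast
    \<comment> \<open>\<open>c\<close> is functional and pairs have unique codes, so there is one
      member per index and only finitely many indices.\<close>
    have "ext mem c \<subseteq> (\<lambda>i. THE p. is_opair mem p i (app mem c i)) ` num mem ` {..m}"
    proof
      fix p assume "p \<in> ext mem c"
      then obtain i z where iz: "i \<in> num mem ` {..m}" "is_opair mem p i z" "(i, z) \<in> rel_of mem c"
        using pr unfolding ext_def by blast
      have "app mem c i = z" using app_eqI[OF f iz(1) iz(3)] .
      then have "(THE p. is_opair mem p i (app mem c i)) = p"
        using iz(2) opair_unique by blast
      then show "p \<in> (\<lambda>i. THE p. is_opair mem p i (app mem c i)) ` num mem ` {..m}"
        using iz(1) by blast
    qed
    then have "finite (ext mem c)" by (rule finite_subset) simp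
    then have "c \<in> ext mem K" using sub K by blast
    then show ?thesis by (simp add: ext_def)
  qed
  then show ?thesis by blast
qed

text \<open>Makes the existence of a chain first-order: the HOL quantifier over sequences becomes a
  quantifier over codes in the universe.\<close>

lemma E_chain_iff_is_chain:
  assumes A: "is_set A" and E: "is_rel E" and F: "is_rel F"
  shows "E_chain E {z \<in> A. (z, b) \<notin> F} x y \<longleftrightarrow>
    (\<exists>c n. is_chain mem nums (set_code mem A) (rel_code mem E) (rel_code mem F) b c n x y)"
proof
  assume "E_chain E {z \<in> A. (z, b) \<notin> F} x y"
  then obtain m d where d: "d 0 = x" "d m = y" "\<And>i. i \<le> m \<Longrightarrow> d i \<in> A \<and> (d i, b) \<notin> F"
    "\<And>i. i < m \<Longrightarrow> (d i, d (Suc i)) \<in> E"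
    unfolding E_chain_def by auto
  define R where "R = (\<lambda>i. (num mem i, d i)) ` {..m}"
  have R: "is_rel R"
    by (rule is_relI[OF is_set_nums A]) (use d(3) in \<open>auto simp: R_def\<close>)
  have Riff: "(num mem i, z) \<in> R \<longleftrightarrow> i \<le> m \<and> z = d i" for i z
    unfolding R_def by auto
  have "is_fun mem (rel_code mem R) (num mem ` {..m})"
    unfolding is_fun_def rel_of_rel_code[OF R] ext_rel_code[OF R] by (auto simp: Riff pairs_of_def R_def)
  then have "is_chain mem nums (set_code mem A) (rel_code mem E) (rel_code mem F) b
      (rel_code mem R) (num mem m) x y"
    unfolding is_chain_def rel_of_rel_code[OF R] rel_of_rel_code[OF E] rel_of_rel_code[OF F]
      upto_num_num mem_set_code[OF A]
    using d ext_num_0 by (auto simp: Riff mem_nums mem_num_iff is_succ_num_iff)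
  then show "\<exists>c n. is_chain mem nums (set_code mem A) (rel_code mem E) (rel_code mem F) b c n x y"
    by blast
next
  assume "\<exists>c n. is_chain mem nums (set_code mem A) (rel_code mem E) (rel_code mem F) b c n x y"
  then obtain c n where ch: "is_chain mem nums (set_code mem A) (rel_code mem E) (rel_code mem F) b c n x y"
    by blast
  then obtain m where n: "n = num mem m" unfolding is_chain_def mem_nums by blast
  have f: "is_fun mem c (num mem ` {..m})"
    using ch unfolding is_chain_def n upto_num_num by blast
  define d where "d i = app mem c (num mem i)" for i
  have rel: "(num mem i, d i) \<in> rel_of mem c" if "i \<le> m" for i
    unfolding d_def by (rule app_rel[OF f]) (use that in auto)
  have eq: "d i = z" if "i \<le> m" "(num mem i, z) \<in> rel_of mem c" for i z
    unfolding d_def by (rule app_eqI[OF f]) (use that in auto)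
  obtain z where z: "ext mem z = {}" "(z, x) \<in> rel_of mem c" using ch unfolding is_chain_def by blast
  \<comment> \<open>The formula names zero only as an empty set; extensionality identifies
    it.\<close>
  have "z = num mem 0" using z(1) ext_num_0 extensional by metis
  then have "d 0 = x" using eq[of 0] z(2) by simp
  moreover have "d m = y" using eq[of m] ch n unfolding is_chain_def by simp
  moreover have "d i \<in> A \<and> (d i, b) \<notin> F" if "i \<le> m" for i
  proof -
    have "mem (num mem i) nums" "mem (num mem i) n \<or> num mem i = n"
      using that by (auto simp: n mem_nums mem_num_iff)
    then have "mem (d i) (set_code mem A) \<and> (d i, b) \<notin> rel_of mem (rel_code mem F)"
      using ch rel[OF that] unfolding is_chain_def by blast
    then show ?thesis by (simp add: rel_of_rel_code[OF F] mem_set_code[OF A])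
  qed
  moreover have "(d i, d (Suc i)) \<in> E" if "i < m" for i
  proof -
    have "mem (num mem i) nums" "mem (num mem i) n" "is_succ mem (num mem (Suc i)) (num mem i)"
      using that by (auto simp: n mem_nums mem_num_iff is_succ_num)
    moreover have "(num mem i, d i) \<in> rel_of mem c" "(num mem (Suc i), d (Suc i)) \<in> rel_of mem c"
      using rel that by auto
    ultimately have "(d i, d (Suc i)) \<in> rel_of mem (rel_code mem E)"
      using ch unfolding is_chain_def by blast
    then show ?thesis by (simp add: rel_of_rel_code[OF E])
  qed
  ultimately show "E_chain E {z \<in> A. (z, b) \<notin> F} x y"
    unfolding E_chain_def by blast
qed

end

section \<open>Transfer\<close>

context nonstandard_universe
begin

text \<open>\<open>P\<close> and \<open>Q\<close> are the interpretations of one formula in the two structures. The index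
  \<open>n\<close> carries no meaning: it names the variable to be used for the next quantifier, and
  therefore should exceed all indices in use.\<close>

definition dfn :: "nat \<Rightarrow> ((nat \<Rightarrow> 'u) \<Rightarrow> bool) \<Rightarrow> ((nat \<Rightarrow> 'v) \<Rightarrow> bool) \<Rightarrow> bool" where
  "dfn n P Q \<longleftrightarrow> (\<exists>\<phi>. (\<forall>v. sat mem \<phi> v \<longleftrightarrow> P v) \<and> (\<forall>v. sat smem \<phi> v \<longleftrightarrow> Q v))"

lemma dfn_transfer: "dfn n P Q \<Longrightarrow> P v \<longleftrightarrow> Q (star \<circ> v)"
  unfolding dfn_def using elementary by blast

lemma dfn_mem: "dfn n (\<lambda>v. mem (v i) (v j)) (\<lambda>v. smem (v i) (v j))"
  unfolding dfn_def by (rule exI[of _ "Mem i j"]) simp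

lemma dfn_eq: "dfn n (\<lambda>v. v i = v j) (\<lambda>v. v i = v j)"
  unfolding dfn_def by (rule exI[of _ "Eq i j"]) simp

lemma dfn_cong: "dfn n P Q \<Longrightarrow> (\<And>v. P v \<longleftrightarrow> P' v) \<Longrightarrow> (\<And>v. Q v \<longleftrightarrow> Q' v) \<Longrightarrow> dfn n P' Q'"
  unfolding dfn_def by simp

lemma dfn_not:
  assumes "dfn n P Q"
  shows "dfn n (\<lambda>v. \<not> P v) (\<lambda>v. \<not> Q v)"
proof -
  obtain \<phi> where "\<And>v. sat mem \<phi> v \<longleftrightarrow> P v" "\<And>v. sat smem \<phi> v \<longleftrightarrow> Q v"
    using assms unfolding dfn_def by blast
  then show ?thesis unfolding dfn_def by (intro exI[of _ "Neg \<phi>"]) simp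
qed

lemma dfn_conj:
  assumes "dfn n P Q" "dfn n P' Q'"
  shows "dfn n (\<lambda>v. P v \<and> P' v) (\<lambda>v. Q v \<and> Q' v)"
proof -
  obtain \<phi> where "\<And>v. sat mem \<phi> v \<longleftrightarrow> P v" "\<And>v. sat smem \<phi> v \<longleftrightarrow> Q v"
    using assms(1) unfolding dfn_def by blast
  moreover obtain \<psi> where "\<And>v. sat mem \<psi> v \<longleftrightarrow> P' v" "\<And>v. sat smem \<psi> v \<longleftrightarrow> Q' v"
    using assms(2) unfolding dfn_def by blast
  ultimately show ?thesis unfolding dfn_def by (intro exI[of _ "Conj \<phi> \<psi>"]) simp
qed

lemma dfn_disj: "dfn n P Q \<Longrightarrow> dfn n P' Q' \<Longrightarrow> dfn n (\<lambda>v. P v \<or> P' v) (\<lambda>v. Q v \<or> Q' v)"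
  by (rule dfn_cong[OF dfn_not[OF dfn_conj[OF dfn_not dfn_not]]]) auto

lemma dfn_imp: "dfn n P Q \<Longrightarrow> dfn n P' Q' \<Longrightarrow> dfn n (\<lambda>v. P v \<longrightarrow> P' v) (\<lambda>v. Q v \<longrightarrow> Q' v)"
  by (rule dfn_cong[OF dfn_disj[OF dfn_not]]) auto

lemma dfn_iff: "dfn n P Q \<Longrightarrow> dfn n P' Q' \<Longrightarrow> dfn n (\<lambda>v. P v \<longleftrightarrow> P' v) (\<lambda>v. Q v \<longleftrightarrow> Q' v)"
  by (rule dfn_cong[OF dfn_conj[OF dfn_imp[of n P Q P' Q'] dfn_imp[of n P' Q' P Q]]]) auto

text \<open>The first two premises say that \<open>P x\<close> and \<open>Q x\<close> do not read
  slot \<open>n\<close>, which is then free to hold the bound variable. \<open>simp\<close> solves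
  them when all slots in use lie below \<open>n\<close>.\<close>

lemma dfn_ex:
  assumes "\<And>v x y. P x (v(n := y)) = P x v" "\<And>v x y. Q x (v(n := y)) = Q x v"
    and "dfn (Suc n) (\<lambda>v. P (v n) v) (\<lambda>v. Q (v n) v)"
  shows "dfn n (\<lambda>v. \<exists>x. P x v) (\<lambda>v. \<exists>x. Q x v)"
proof -
  obtain \<phi> where "\<And>v. sat mem \<phi> v \<longleftrightarrow> P (v n) v" "\<And>v. sat smem \<phi> v \<longleftrightarrow> Q (v n) v"
    using assms(3) unfolding dfn_def by blast
  then show ?thesis
    unfolding dfn_def by (intro exI[of _ "Exi n \<phi>"]) (simp add: assms(1,2))
qed

lemma dfn_all:
  assumes "\<And>v x y. P x (v(n := y)) = P x v" "\<And>v x y. Q x (v(n := y)) = Q x v"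
    and "dfn (Suc n) (\<lambda>v. P (v n) v) (\<lambda>v. Q (v n) v)"
  shows "dfn n (\<lambda>v. \<forall>x. P x v) (\<lambda>v. \<forall>x. Q x v)"
  by (rule dfn_cong[OF dfn_not[OF dfn_ex[of "\<lambda>x v. \<not> P x v" n "\<lambda>x v. \<not> Q x v"]]])
    (auto simp: assms(1,2) intro: dfn_not assms(3))

lemmas dfn_logic = dfn_mem dfn_eq dfn_not dfn_conj dfn_disj dfn_imp dfn_iff dfn_ex dfn_all

lemma dfn_upair:
  "i < n \<Longrightarrow> j < n \<Longrightarrow> k < n \<Longrightarrow>
    dfn n (\<lambda>v. is_upair mem (v i) (v j) (v k)) (\<lambda>v. is_upair smem (v i) (v j) (v k))"
  unfolding is_upair_iff by (intro dfn_logic; simp)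

lemma dfn_opair:
  "i < n \<Longrightarrow> j < n \<Longrightarrow> k < n \<Longrightarrow>
    dfn n (\<lambda>v. is_opair mem (v i) (v j) (v k)) (\<lambda>v. is_opair smem (v i) (v j) (v k))"
  unfolding is_opair_def by (intro dfn_logic dfn_upair; simp)

lemma dfn_succ:
  "i < n \<Longrightarrow> j < n \<Longrightarrow> dfn n (\<lambda>v. is_succ mem (v i) (v j)) (\<lambda>v. is_succ smem (v i) (v j))"
  unfolding is_succ_iff by (intro dfn_logic; simp)

lemma dfn_rel_of:
  "i < n \<Longrightarrow> j < n \<Longrightarrow> k < n \<Longrightarrow>
    dfn n (\<lambda>v. (v i, v j) \<in> rel_of mem (v k)) (\<lambda>v. (v i, v j) \<in> rel_of smem (v k))"
  unfolding rel_of_iff by (intro dfn_logic dfn_opair; simp)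

lemma dfn_chain:
  "iw < m \<Longrightarrow> ia < m \<Longrightarrow> ie < m \<Longrightarrow> jf < m \<Longrightarrow> ib < m \<Longrightarrow> ic < m \<Longrightarrow> jn < m \<Longrightarrow> ix < m \<Longrightarrow> iy < m \<Longrightarrow>
    dfn m (\<lambda>v. is_chain mem (v iw) (v ia) (v ie) (v jf) (v ib) (v ic) (v jn) (v ix) (v iy))
      (\<lambda>v. is_chain smem (v iw) (v ia) (v ie) (v jf) (v ib) (v ic) (v jn) (v ix) (v iy))"
  unfolding is_chain_def is_fun_upto_num_iff ext_empty_iff
  by (intro dfn_logic dfn_opair dfn_succ dfn_rel_of; simp)

lemmas dfn_intros = dfn_logic dfn_upair dfn_opair dfn_succ dfn_rel_of dfn_chain

section \<open>The star of sets and relations\<close>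

abbreviation sset :: "'u set \<Rightarrow> 'v set" where "sset \<equiv> star_set mem smem star"
abbreviation srel :: "('u \<times> 'u) set \<Rightarrow> ('v \<times> 'v) set" where "srel \<equiv> star_rel mem smem star"

lemma smem_extensional: "(\<And>x. smem x a \<longleftrightarrow> smem x b) \<Longrightarrow> a = b"
proof -
  have "dfn 0 (\<lambda>v. \<forall>a b. (\<forall>x. mem x a \<longleftrightarrow> mem x b) \<longrightarrow> a = b)
    (\<lambda>v. \<forall>a b. (\<forall>x. smem x a \<longleftrightarrow> smem x b) \<longrightarrow> a = b)"
    by (intro dfn_intros; simp)
  from dfn_transfer[OF this] have "\<forall>a b. (\<forall>x. smem x a \<longleftrightarrow> smem x b) \<longrightarrow> a = b"
    using extensional unfolding ext_def by auto
  then show "(\<And>x. smem x a \<longleftrightarrow> smem x b) \<Longrightarrow> a = b" by blast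
qed

lemma star_mem: "smem (star a) (star b) \<longleftrightarrow> mem a b"
  using dfn_transfer[OF dfn_mem[of 0 0 1], of "(!) [a, b]"] by simp

lemma star_inject: "star a = star b \<longleftrightarrow> a = b"
  using dfn_transfer[OF dfn_eq[of 0 0 1], of "(!) [a, b]"] by simp

lemma sset_iff: "x \<in> sset A \<longleftrightarrow> smem x (star (set_code mem A))"
  unfolding star_set_def ext_def by simp

text \<open>The pattern of transfers with parameters: the valuation \<open>(!) [...]\<close> puts
  the listed elements in slots 0, 1, and so on, and the number given to \<open>dfn\<close> is the
  length of the list, so that quantifiers use fresh slots.\<close>

lemma srel_mono:
  assumes "is_rel S" "R \<subseteq> S"
  shows "srel R \<subseteq> srel S"
proof -
  note R = is_rel_subset[OF assms]
  have "dfn 2 (\<lambda>v. \<forall>x y. (x, y) \<in> rel_of mem (v 0) \<longrightarrow> (x, y) \<in> rel_of mem (v 1))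
    (\<lambda>v. \<forall>x y. (x, y) \<in> rel_of smem (v 0) \<longrightarrow> (x, y) \<in> rel_of smem (v 1))"
    by (intro dfn_intros; simp)
  from dfn_transfer[OF this, of "(!) [rel_code mem R, rel_code mem S]"] show ?thesis
    using assms R unfolding star_rel_def by (auto simp: rel_of_rel_code)
qed

text \<open>With \<open>srel_mono\<close> and \<open>srel_converse\<close>, this allows later proofs
  to establish an inclusion between composites of standard relations and pass to stars once.\<close>

lemma srel_comp:
  assumes "is_rel R" "is_rel S"
  shows "srel (R O S) = srel R O srel S"
proof -
  note RS = is_rel_comp[OF assms]
  have "dfn 3
    (\<lambda>v. \<forall>x y. (x, y) \<in> rel_of mem (v 0) \<longleftrightarrow>
      (\<exists>z. (x, z) \<in> rel_of mem (v 1) \<and> (z, y) \<in> rel_of mem (v 2)))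
    (\<lambda>v. \<forall>x y. (x, y) \<in> rel_of smem (v 0) \<longleftrightarrow>
      (\<exists>z. (x, z) \<in> rel_of smem (v 1) \<and> (z, y) \<in> rel_of smem (v 2)))"
    by (intro dfn_intros; simp)
  from dfn_transfer[OF this, of "(!) [rel_code mem (R O S), rel_code mem R, rel_code mem S]"]
  have "\<forall>x y. (x, y) \<in> srel (R O S) \<longleftrightarrow> (\<exists>z. (x, z) \<in> srel R \<and> (z, y) \<in> srel S)"
    using assms RS unfolding star_rel_def by (auto simp: rel_of_rel_code)
  then show ?thesis by auto
qed

lemma srel_converse:
  assumes "is_rel R"
  shows "srel (R\<inverse>) = (srel R)\<inverse>"
proof -
  note R' = is_rel_converse[OF assms]
  have "dfn 2 (\<lambda>v. \<forall>x y. (x, y) \<in> rel_of mem (v 0) \<longleftrightarrow> (y, x) \<in> rel_of mem (v 1))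
    (\<lambda>v. \<forall>x y. (x, y) \<in> rel_of smem (v 0) \<longleftrightarrow> (y, x) \<in> rel_of smem (v 1))"
    by (intro dfn_intros; simp)
  from dfn_transfer[OF this, of "(!) [rel_code mem (R\<inverse>), rel_code mem R]"]
  have "\<forall>x y. (x, y) \<in> srel (R\<inverse>) \<longleftrightarrow> (y, x) \<in> srel R"
    using assms R' unfolding star_rel_def by (auto simp: rel_of_rel_code)
  then show ?thesis by auto
qed

lemma srel_Times:
  assumes "is_set A" "is_set B"
  shows "srel (A \<times> B) = sset A \<times> sset B"
proof -
  note AB = is_rel_Times[OF assms]
  have "dfn 3 (\<lambda>v. \<forall>x y. (x, y) \<in> rel_of mem (v 0) \<longleftrightarrow> mem x (v 1) \<and> mem y (v 2))
    (\<lambda>v. \<forall>x y. (x, y) \<in> rel_of smem (v 0) \<longleftrightarrow> smem x (v 1) \<and> smem y (v 2))"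
    by (intro dfn_intros; simp)
  from dfn_transfer[OF this, of "(!) [rel_code mem (A \<times> B), set_code mem A, set_code mem B]"]
  have "\<forall>x y. (x, y) \<in> srel (A \<times> B) \<longleftrightarrow> x \<in> sset A \<and> y \<in> sset B"
    using assms AB unfolding star_rel_def by (auto simp: rel_of_rel_code mem_set_code sset_iff)
  then show ?thesis by auto
qed

lemma srel_Id_on:
  assumes "is_set A"
  shows "srel (Id_on A) = Id_on (sset A)"
proof -
  note A = is_rel_Id_on[OF assms]
  have "dfn 2 (\<lambda>v. \<forall>x y. (x, y) \<in> rel_of mem (v 0) \<longleftrightarrow> mem x (v 1) \<and> y = x)
    (\<lambda>v. \<forall>x y. (x, y) \<in> rel_of smem (v 0) \<longleftrightarrow> smem x (v 1) \<and> y = x)"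
    by (intro dfn_intros; simp)
  from dfn_transfer[OF this, of "(!) [rel_code mem (Id_on A), set_code mem A]"]
  have "\<forall>x y. (x, y) \<in> srel (Id_on A) \<longleftrightarrow> x \<in> sset A \<and> y = x"
    using assms A unfolding star_rel_def by (auto simp: rel_of_rel_code mem_set_code sset_iff)
  then show ?thesis by auto
qed

text \<open>Used contrapositively: a relation whose star has a member is itself nonempty.\<close>

lemma srel_empty: "srel {} = {}"
proof -
  have e: "is_rel {}" using is_rel_subset[OF is_rel_Id_on[OF is_set_singleton]] by blast
  have "dfn 1 (\<lambda>v. \<forall>x y. (x, y) \<notin> rel_of mem (v 0)) (\<lambda>v. \<forall>x y. (x, y) \<notin> rel_of smem (v 0))"
    by (intro dfn_intros; simp)
  from dfn_transfer[OF this, of "(!) [rel_code mem {}]"] show ?thesis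
    using e unfolding star_rel_def by (auto simp: rel_of_rel_code)
qed

lemma sset_Un:
  assumes "is_set (A \<union> B)"
  shows "sset (A \<union> B) = sset A \<union> sset B"
proof -
  have AB: "is_set A" "is_set B" by (auto intro: is_set_subset[OF assms])
  have "dfn 3 (\<lambda>v. \<forall>x. mem x (v 0) \<longleftrightarrow> mem x (v 1) \<or> mem x (v 2))
    (\<lambda>v. \<forall>x. smem x (v 0) \<longleftrightarrow> smem x (v 1) \<or> smem x (v 2))"
    by (intro dfn_intros; simp)
  from dfn_transfer[OF this, of "(!) [set_code mem (A \<union> B), set_code mem A, set_code mem B]"]
  show ?thesis
    using assms AB by (auto simp: mem_set_code sset_iff)
qed

lemma sset_singleton: "sset {a} = {star a}"
proof -
  have "dfn 2 (\<lambda>v. \<forall>x. mem x (v 0) \<longleftrightarrow> x = v 1) (\<lambda>v. \<forall>x. smem x (v 0) \<longleftrightarrow> x = v 1)"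
    by (intro dfn_intros; simp)
  from dfn_transfer[OF this, of "(!) [set_code mem {a}, a]"]
  have "\<forall>x. x \<in> sset {a} \<longleftrightarrow> x = star a"
    by (simp add: mem_set_code sset_iff is_set_singleton)
  then show ?thesis by blast
qed

lemma sset_empty: "sset {} = {}"
proof -
  have e: "is_set {}" by (rule is_set_subset[OF is_set_singleton]) simp
  have "dfn 1 (\<lambda>v. \<forall>x. \<not> mem x (v 0)) (\<lambda>v. \<forall>x. \<not> smem x (v 0))"
    by (intro dfn_intros; simp)
  from dfn_transfer[OF this, of "(!) [set_code mem {}]"] show ?thesis
    using e by (auto simp: mem_set_code sset_iff)
qed

lemma sset_finite:
  assumes "finite A" "is_set A"
  shows "sset A = star ` A"
  using assms
proof (induction A rule: finite_induct)
  case empty show ?case by (simp add: sset_empty)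
next
  case (insert a A)
  have "is_set A" using insert.prems by (rule is_set_subset) blast
  then have "sset A = star ` A" by (rule insert.IH)
  then show ?case
    using sset_Un[of "{a}" A] insert.prems by (simp add: sset_singleton)
qed

lemma sset_Collect_not_rel:
  assumes "is_set A" "is_rel F"
  shows "sset {z \<in> A. (z, b) \<notin> F} = {z \<in> sset A. (z, star b) \<notin> srel F}"
proof -
  have A': "is_set {z \<in> A. (z, b) \<notin> F}" by (rule is_set_subset[OF assms(1)]) auto
  have "dfn 4 (\<lambda>v. \<forall>x. mem x (v 0) \<longleftrightarrow> mem x (v 1) \<and> (x, v 2) \<notin> rel_of mem (v 3))
    (\<lambda>v. \<forall>x. smem x (v 0) \<longleftrightarrow> smem x (v 1) \<and> (x, v 2) \<notin> rel_of smem (v 3))"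
    by (intro dfn_intros; simp)
  from dfn_transfer[OF this, of "(!) [set_code mem {z \<in> A. (z, b) \<notin> F}, set_code mem A, b, rel_code mem F]"]
  have "\<forall>x. x \<in> sset {z \<in> A. (z, b) \<notin> F} \<longleftrightarrow> x \<in> sset A \<and> (x, star b) \<notin> srel F"
    using assms A' unfolding star_rel_def by (simp add: rel_of_rel_code mem_set_code sset_iff)
  then show ?thesis by blast
qed

text \<open>Totality and uniqueness of values transfer from the graph to its star, so the definite
  description in \<open>app\<close> picks the actual value.\<close>

lemma srel_graph:
  assumes A: "is_set A" and B: "is_set B" and f: "f \<in> A \<rightarrow> B" and x: "x \<in> sset A"
  defines "G \<equiv> (\<lambda>a. (a, f a)) ` A"
  shows "(x, y) \<in> srel G \<longleftrightarrow> y = app smem (star (rel_code mem G)) x"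
proof -
  have G: "is_rel G" by (rule is_relI[OF A B]) (use f in \<open>auto simp: G_def\<close>)
  have "dfn 2
    (\<lambda>v. \<forall>x. mem x (v 0) \<longrightarrow>
      (\<exists>y. (x, y) \<in> rel_of mem (v 1) \<and> (\<forall>z. (x, z) \<in> rel_of mem (v 1) \<longrightarrow> z = y)))
    (\<lambda>v. \<forall>x. smem x (v 0) \<longrightarrow>
      (\<exists>y. (x, y) \<in> rel_of smem (v 1) \<and> (\<forall>z. (x, z) \<in> rel_of smem (v 1) \<longrightarrow> z = y)))"
    by (intro dfn_intros; simp)
  note dfn_transfer[OF this, of "(!) [set_code mem A, rel_code mem G]"]
  moreover have "\<forall>x. x \<in> A \<longrightarrow> (\<exists>y. (x, y) \<in> G \<and> (\<forall>z. (x, z) \<in> G \<longrightarrow> z = y))"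
    unfolding G_def by auto
  ultimately have "\<forall>x. x \<in> sset A \<longrightarrow> (\<exists>y. (x, y) \<in> srel G \<and> (\<forall>z. (x, z) \<in> srel G \<longrightarrow> z = y))"
    using A G unfolding star_rel_def sset_iff by (simp add: rel_of_rel_code mem_set_code)
  then have ex: "\<exists>!y. (x, y) \<in> srel G" using x by blast
  have "app smem (star (rel_code mem G)) x = (THE y. (x, y) \<in> srel G)"
    unfolding app_def star_rel_def ..
  then show ?thesis using theI'[OF ex] ex by auto
qed

section \<open>Hypernatural numbers\<close>

lemma star_nat_iff: "i \<in> star_nat mem smem star \<longleftrightarrow> smem i (star nums)"
  unfolding star_nat_def nums_def by (rule sset_iff)

lemma smem_asym: "smem x y \<Longrightarrow> \<not> smem y x"
proof -
  have "dfn 0 (\<lambda>v. \<forall>x y. mem x y \<longrightarrow> \<not> mem y x) (\<lambda>v. \<forall>x y. smem x y \<longrightarrow> \<not> smem y x)"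
    by (intro dfn_intros; simp)
  from dfn_transfer[OF this] have "\<forall>x y. smem x y \<longrightarrow> \<not> smem y x"
    by (simp add: mem_asym)
  then show "smem x y \<Longrightarrow> \<not> smem y x" by blast
qed

lemma ext_star_0: "ext smem (star (num mem 0)) = {}"
proof -
  have "dfn 1 (\<lambda>v. \<forall>x. \<not> mem x (v 0)) (\<lambda>v. \<forall>x. \<not> smem x (v 0))"
    by (intro dfn_intros; simp)
  from dfn_transfer[OF this, of "(!) [num mem 0]"] show ?thesis
    using ext_num_0 by (simp add: ext_empty_iff)
qed

lemma star_0_unique: "ext smem z = {} \<Longrightarrow> z = star (num mem 0)"
  using ext_star_0 unfolding ext_empty_iff by (intro smem_extensional) simp

lemma star_0_in: "smem n (star nums) \<Longrightarrow> star (num mem 0) \<in> upto_num smem (star nums) n"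
proof -
  have "dfn 2 (\<lambda>v. \<forall>n. mem n (v 0) \<longrightarrow> mem (v 1) (v 0) \<and> (mem (v 1) n \<or> v 1 = n))
    (\<lambda>v. \<forall>n. smem n (v 0) \<longrightarrow> smem (v 1) (v 0) \<and> (smem (v 1) n \<or> v 1 = n))"
    by (intro dfn_intros; simp)
  from dfn_transfer[OF this, of "(!) [nums, num mem 0]"]
  have "(\<forall>n. mem n nums \<longrightarrow> mem (num mem 0) nums \<and> (mem (num mem 0) n \<or> num mem 0 = n)) \<longleftrightarrow>
    (\<forall>n. smem n (star nums) \<longrightarrow> star (num mem 0) \<in> upto_num smem (star nums) n)"
    by simp
  moreover have "\<forall>n. mem n nums \<longrightarrow> mem (num mem 0) nums \<and> (mem (num mem 0) n \<or> num mem 0 = n)"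
    by (auto simp: mem_nums mem_num_iff)
  ultimately have "\<forall>n. smem n (star nums) \<longrightarrow> star (num mem 0) \<in> upto_num smem (star nums) n"
    by blast
  then show "smem n (star nums) \<Longrightarrow> star (num mem 0) \<in> upto_num smem (star nums) n" by blast
qed

lemma succ_eq: "is_succ smem j i \<Longrightarrow> succ smem i = j"
  unfolding succ_def is_succ_iff by (rule the_equality, assumption, rule smem_extensional) simp

lemma succ_in:
  assumes "smem i (star nums)" "smem n (star nums)" "smem i n"
  shows "is_succ smem (succ smem i) i \<and> succ smem i \<in> upto_num smem (star nums) n"
proof -
  have "dfn 1 (\<lambda>v. \<forall>i n. mem i (v 0) \<and> mem n (v 0) \<and> mem i n \<longrightarrow>
      (\<exists>j. is_succ mem j i \<and> mem j (v 0) \<and> (mem j n \<or> j = n)))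
    (\<lambda>v. \<forall>i n. smem i (v 0) \<and> smem n (v 0) \<and> smem i n \<longrightarrow>
      (\<exists>j. is_succ smem j i \<and> smem j (v 0) \<and> (smem j n \<or> j = n)))"
    by (intro dfn_intros; simp)
  from dfn_transfer[OF this, of "(!) [nums]"]
  have "(\<forall>i n. mem i nums \<and> mem n nums \<and> mem i n \<longrightarrow>
      (\<exists>j. is_succ mem j i \<and> mem j nums \<and> (mem j n \<or> j = n))) \<longleftrightarrow>
    (\<forall>i n. smem i (star nums) \<and> smem n (star nums) \<and> smem i n \<longrightarrow>
      (\<exists>j. is_succ smem j i \<and> smem j (star nums) \<and> (smem j n \<or> j = n)))"
    by simp
  moreover have "\<exists>j. is_succ mem j i \<and> mem j nums \<and> (mem j n \<or> j = n)"
    if that': "mem i nums" "mem n nums" "mem i n" for i n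
  proof -
    obtain k l where "i = num mem k" "n = num mem l" "k < l"
      using that' by (auto simp: mem_nums mem_num_iff)
    then show ?thesis
      by (intro exI[of _ "num mem (Suc k)"]) (auto simp: mem_nums mem_num_iff is_succ_num)
  qed
  ultimately have "\<exists>j. is_succ smem j i \<and> smem j (star nums) \<and> (smem j n \<or> j = n)"
    using assms by blast
  then show ?thesis using succ_eq by blast
qed

text \<open>Each endpoint lies in the segment of the other. If they differed, each would be a member
  of the other, which transferred asymmetry excludes.\<close>

lemma upto_num_inject:
  assumes "smem n (star nums)" "smem m (star nums)"
    and "upto_num smem (star nums) n = upto_num smem (star nums) m"
  shows "n = m"
proof -
  have "n \<in> upto_num smem (star nums) m" "m \<in> upto_num smem (star nums) n"
    using assms by blast+
  then show ?thesis using smem_asym by blast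
qed

text \<open>A finite set gains no elements under the star map, so everything new lies beyond the
  finitely many numerals below \<open>N\<close>.\<close>

lemma infinite_nat_tail:
  assumes "i \<in> infinite_nat mem smem star"
  shows "i \<in> sset (num mem ` {N..})"
proof -
  have "range (num mem) = num mem ` {..<N} \<union> num mem ` {N..}"
    by (auto simp flip: image_Un)
  then have "star_nat mem smem star = sset (num mem ` {..<N}) \<union> sset (num mem ` {N..})"
    unfolding star_nat_def using sset_Un is_set_nums by metis
  moreover have "sset (num mem ` {..<N}) \<subseteq> star ` range (num mem)"
    by (subst sset_finite) (auto simp: is_set_num_image)
  ultimately show ?thesis using assms unfolding infinite_nat_def by blast
qed

text \<open>Saturation for the internal sets of hypernaturals other than \<open>k\<close>, one for
  each standard numeral \<open>k\<close>: any finitely many of them still share a standard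
  numeral.\<close>

lemma infinite_nat_nonempty: "infinite_nat mem smem star \<noteq> {}"
proof -
  have "dfn 1 (\<lambda>v. \<forall>k. \<exists>b. \<forall>i. mem i b \<longleftrightarrow> mem i (v 0) \<and> i \<noteq> k)
    (\<lambda>v. \<forall>k. \<exists>b. \<forall>i. smem i b \<longleftrightarrow> smem i (v 0) \<and> i \<noteq> k)"
    by (intro dfn_intros; simp)
  from dfn_transfer[OF this, of "(!) [nums]"]
  have "(\<forall>k. \<exists>b. \<forall>i. mem i b \<longleftrightarrow> mem i nums \<and> i \<noteq> k) \<longleftrightarrow>
    (\<forall>k. \<exists>b. \<forall>i. smem i b \<longleftrightarrow> smem i (star nums) \<and> i \<noteq> k)"
    by simp
  then have "\<forall>k. \<exists>b. \<forall>i. smem i b \<longleftrightarrow> smem i (star nums) \<and> i \<noteq> k"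
    using separation[of nums] by simp
  then have "\<exists>F. \<forall>k i. smem i (F k) \<longleftrightarrow> smem i (star nums) \<and> i \<noteq> k" by (rule choice)
  then obtain F where F: "\<And>k i. smem i (F (star k)) \<longleftrightarrow> smem i (star nums) \<and> i \<noteq> star k"
    by blast
  have "\<exists>y. \<forall>j\<in>ext mem nums. y \<in> ext smem (F (star j))"
  proof (rule saturated)
    fix J assume J: "finite J" "J \<subseteq> ext mem nums"
    have "infinite (range (num mem))"
      by (simp add: finite_image_iff inj_def)
    then have "\<not> range (num mem) \<subseteq> J" using J(1) finite_subset[of "range (num mem)" J] by auto
    then obtain n where "num mem n \<notin> J" by blast
    then have "star (num mem n) \<in> ext smem (F (star j))" if "j \<in> J" for j
    proof -
      have "j \<in> range (num mem)" using J(2) that by (auto simp: ext_def mem_nums)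
      then show ?thesis using \<open>num mem n \<notin> J\<close> that
        by (auto simp: ext_def F star_mem star_inject mem_nums)
    qed
    then show "\<exists>y. \<forall>j\<in>J. y \<in> ext smem (F (star j))" by blast
  qed
  then obtain y where y: "\<And>j. mem j nums \<Longrightarrow> smem y (star nums) \<and> y \<noteq> star j"
    unfolding ext_def by (auto simp: F)
  have "smem y (star nums)" "y \<noteq> star (num mem n)" for n
    using y[of "num mem n"] by (auto simp: mem_nums)
  then have "y \<in> infinite_nat mem smem star"
    by (auto simp: infinite_nat_def star_nat_iff)
  then show ?thesis by blast
qed

end

section \<open>Coarse spaces\<close>

lemma
  assumes "pointed_coarse_space X"
  shows base_in_pts: "base X \<in> pts X"
    and ctrl_Times: "E \<in> ctrl X \<Longrightarrow> E \<subseteq> pts X \<times> pts X"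
    and ctrl_subset: "E \<in> ctrl X \<Longrightarrow> F \<subseteq> E \<Longrightarrow> F \<in> ctrl X"
    and ctrl_Un: "E \<in> ctrl X \<Longrightarrow> F \<in> ctrl X \<Longrightarrow> E \<union> F \<in> ctrl X"
    and ctrl_Id_on: "Id_on (pts X) \<in> ctrl X"
    and ctrl_comp: "E \<in> ctrl X \<Longrightarrow> F \<in> ctrl X \<Longrightarrow> E O F \<in> ctrl X"
    and ctrl_converse: "E \<in> ctrl X \<Longrightarrow> E\<inverse> \<in> ctrl X"
proof -
  note X = assms[unfolded pointed_coarse_space_def]
  show "base X \<in> pts X" "Id_on (pts X) \<in> ctrl X" using X by simp_all
  show "E \<in> ctrl X \<Longrightarrow> E \<subseteq> pts X \<times> pts X" using X by (simp add: subset_iff Pow_def)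
  show "E \<in> ctrl X \<Longrightarrow> F \<subseteq> E \<Longrightarrow> F \<in> ctrl X" using X by simp
  show "E \<in> ctrl X \<Longrightarrow> F \<in> ctrl X \<Longrightarrow> E \<union> F \<in> ctrl X" using X by simp
  show "E \<in> ctrl X \<Longrightarrow> F \<in> ctrl X \<Longrightarrow> E O F \<in> ctrl X" using X by simp
  show "E \<in> ctrl X \<Longrightarrow> E\<inverse> \<in> ctrl X" using X by simp
qed

lemma ctrl_finite_Un:
  assumes "pointed_coarse_space X" "finite J" "J \<subseteq> ctrl X"
  shows "\<Union>J \<in> ctrl X"
  using assms(2,3)
proof (induction J rule: finite_induct)
  case empty
  show ?case using ctrl_subset[OF assms(1) ctrl_Id_on[OF assms(1)], of "{}"] by simp
next
  case (insert E J)
  then show ?case using ctrl_Un[OF assms(1)] by simp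
qed

text \<open>Any two points of the ball are related through the basepoint, so its square lies in a
  composite of controlled sets. The basepoint is added because \<open>eps_rel\<close> tests bounded
  sets that contain it; the diagonal in \<open>?G\<close> relates it to itself.\<close>

lemma cbounded_ball:
  assumes X: "pointed_coarse_space X" and F: "F \<in> ctrl X"
  shows "cbounded X (insert (base X) {z \<in> pts X. (z, base X) \<in> F})"
proof -
  let ?G = "F \<union> Id_on (pts X)"
  let ?B = "insert (base X) {z \<in> pts X. (z, base X) \<in> F}"
  have G: "?G \<in> ctrl X" using ctrl_Un[OF X F ctrl_Id_on[OF X]] .
  have "(z, base X) \<in> ?G" if "z \<in> ?B" for z
    using that base_in_pts[OF X] by auto
  then have "?B \<times> ?B \<subseteq> ?G O ?G\<inverse>" by blast
  moreover have "?G O ?G\<inverse> \<in> ctrl X" using ctrl_comp[OF X G ctrl_converse[OF X G]] .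
  ultimately show ?thesis
    unfolding cbounded_def using ctrl_subset[OF X] base_in_pts[OF X] by blast
qed

section \<open>Calculus of chains and connected components\<close>

lemma E_chain_refl: "x \<in> A \<Longrightarrow> E_chain E A x x"
  unfolding E_chain_def by (rule exI[of _ 0], rule exI[of _ "\<lambda>_. x"]) simp

text \<open>The map \<open>g\<close> is carried along so that one lemma covers inclusions
  (\<open>g = id\<close>) and the pushforward of chains along coarse maps.\<close>

lemma E_chain_mono:
  assumes "E_chain E A x y" "\<And>u v. (u, v) \<in> E \<Longrightarrow> u \<in> A \<Longrightarrow> v \<in> A \<Longrightarrow> (g u, g v) \<in> E'"
    and "\<And>u. u \<in> A \<Longrightarrow> g u \<in> A'"
  shows "E_chain E' A' (g x) (g y)"
proof -
  obtain n c where c: "c 0 = x" "c n = y" "\<And>i. i \<le> n \<Longrightarrow> c i \<in> A"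
    "\<And>i. i < n \<Longrightarrow> (c i, c (Suc i)) \<in> E"
    using assms(1) unfolding E_chain_def by auto
  show ?thesis
    unfolding E_chain_def
    by (rule exI[of _ n], rule exI[of _ "g \<circ> c"]) (use c assms(2,3) in auto)
qed

lemma E_chain_in: "E_chain E A x y \<Longrightarrow> x \<in> A \<and> y \<in> A"
  unfolding E_chain_def by auto

lemma E_chain_trans:
  assumes "E_chain E A x y" "E_chain E A y z"
  shows "E_chain E A x z"
proof -
  obtain n c where c: "c 0 = x" "c n = y" "\<And>i. i \<le> n \<Longrightarrow> c i \<in> A"
    "\<And>i. i < n \<Longrightarrow> (c i, c (Suc i)) \<in> E"
    using assms(1) unfolding E_chain_def by auto
  obtain m d where d: "d 0 = y" "d m = z" "\<And>i. i \<le> m \<Longrightarrow> d i \<in> A"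
    "\<And>i. i < m \<Longrightarrow> (d i, d (Suc i)) \<in> E"
    using assms(2) unfolding E_chain_def by auto
  \<comment> \<open>The pieces overlap at index \<open>n\<close>, where
    \<open>c n = y = d 0\<close>; hence \<open>e (n + i) = d i\<close> holds for
    \<open>i = 0\<close> as well.\<close>
  define e where "e i = (if i \<le> n then c i else d (i - n))" for i
  have e: "e (n + i) = d i" for i
    unfolding e_def using c(2) d(1) by (cases i) auto
  have "(e i, e (Suc i)) \<in> E" if "i < n + m" for i
  proof (cases "i < n")
    case True then show ?thesis using c(4)[of i] by (simp add: e_def)
  next
    case False
    then show ?thesis using that d(4)[of "i - n"] e[of "i - n"] e[of "Suc (i - n)"] by simp
  qed
  moreover have "e 0 = x" "e (n + m) = z" using c(1) e[of m] d(2) by (auto simp: e_def)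
  moreover have "e i \<in> A" if "i \<le> n + m" for i
    using that c(3) d(3) by (auto simp: e_def)
  ultimately show ?thesis unfolding E_chain_def by blast
qed

lemma E_chain_converse:
  assumes "E_chain E A x y"
  shows "E_chain (E\<inverse>) A y x"
proof -
  obtain n c where c: "c 0 = x" "c n = y" "\<And>i. i \<le> n \<Longrightarrow> c i \<in> A"
    "\<And>i. i < n \<Longrightarrow> (c i, c (Suc i)) \<in> E"
    using assms(1) unfolding E_chain_def by auto
  have "(c (n - i), c (n - Suc i)) \<in> E\<inverse>" if "i < n" for i
    using c(4)[of "n - Suc i"] that by (simp add: Suc_diff_Suc)
  then show ?thesis
    unfolding E_chain_def by (intro exI[of _ n] exI[of _ "\<lambda>i. c (n - i)"]) (use c in auto)
qed

lemma E_chain_step: "x \<in> A \<Longrightarrow> y \<in> A \<Longrightarrow> (x, y) \<in> E \<Longrightarrow> E_chain E A x y"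
  unfolding E_chain_def
  by (rule exI[of _ 1], rule exI[of _ "\<lambda>i. if i = 0 then x else y"]) auto

lemma E_chain_interval:
  assumes "\<And>i. i \<ge> N \<Longrightarrow> s i \<in> A" "\<And>i. i \<ge> N \<Longrightarrow> (s i, s (Suc i)) \<in> E"
    and "N \<le> i" "i \<le> j"
  shows "E_chain E A (s i) (s j)"
  using \<open>i \<le> j\<close>
proof (induction j rule: dec_induct)
  case base show ?case using assms by (intro E_chain_refl) auto
next
  case (step j)
  then show ?case using E_chain_trans[OF step.IH E_chain_step] assms by auto
qed

text \<open>Symmetry reverses chains, so any two points reached from \<open>x\<close> are joined
  through \<open>x\<close>. A connected superset inside \<open>A\<close> is also reached from
  \<open>x\<close>, which gives maximality.\<close>

lemma E_component_of_sym:
  assumes "sym E" "x \<in> A"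
  shows "E_component E A {y. E_chain E A x y}"
proof -
  let ?K = "{y. E_chain E A x y}"
  \<comment> \<open>Connectedness asks for chains inside \<open>?K\<close>, not merely inside
    \<open>A\<close>: every prefix of a chain from \<open>x\<close> ends in \<open>?K\<close>, so
    the whole chain stays there.\<close>
  have inner: "E_chain E ?K x y" if xy: "E_chain E A x y" for y
  proof -
    obtain n c where c: "c 0 = x" "c n = y" "\<And>i. i \<le> n \<Longrightarrow> c i \<in> A"
      "\<And>i. i < n \<Longrightarrow> (c i, c (Suc i)) \<in> E"
      using xy unfolding E_chain_def by auto
    have "E_chain E A x (c i)" if "i \<le> n" for i
      unfolding E_chain_def by (rule exI[of _ i], rule exI[of _ c]) (use c that in auto)
    then show ?thesis unfolding E_chain_def using c
      by (intro exI[of _ n] exI[of _ c]) (auto simp: E_chain_def)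
  qed
  have "E_chain E ?K u v" if "u \<in> ?K" "v \<in> ?K" for u v
  proof -
    have "E_chain (E\<inverse>) ?K u x" using E_chain_converse[OF inner] that by simp
    then have "E_chain E ?K u x" using assms(1) by (simp add: sym_conv_converse_eq)
    then show ?thesis using E_chain_trans inner that by fast
  qed
  then have "E_connected E ?K" unfolding E_connected_def by blast
  moreover have "K' = ?K" if K': "?K \<subseteq> K'" "K' \<subseteq> A" "E_connected E K'" for K'
  proof -
    have "x \<in> K'" using K'(1) E_chain_refl[OF assms(2)] by blast
    have "E_chain E A x y" if "y \<in> K'" for y
    proof -
      have "E_chain E K' x y" using K'(3) \<open>x \<in> K'\<close> that unfolding E_connected_def by simp
      from E_chain_mono[OF this, of id E A] show ?thesis using K'(2) by auto
    qed
    then show ?thesis using K'(1) by blast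
  qed
  moreover have "?K \<subseteq> A" using E_chain_in[of E A x] by blast
  ultimately show ?thesis unfolding E_component_def by blast
qed

section \<open>Chains that avoid a ball, and their relation to coarse sequences and maps\<close>

definition far_chains :: "'a pcoarse \<Rightarrow> ('a \<times> 'a) set \<Rightarrow> ('a \<times> 'a) set \<Rightarrow> ('a \<times> 'a) set" where
  "far_chains X E F = {(x, y). E_chain E {z \<in> pts X. (z, base X) \<notin> F} x y}"

lemma far_chains_mono:
  assumes "E \<subseteq> E'" "F' \<subseteq> F"
  shows "far_chains X E F \<subseteq> far_chains X E' F'"
proof (rule subrelI)
  fix x y assume "(x, y) \<in> far_chains X E F"
  then have "E_chain E {z \<in> pts X. (z, base X) \<notin> F} x y" unfolding far_chains_def by simp
  from E_chain_mono[OF this, of id E' "{z \<in> pts X. (z, base X) \<notin> F'}"] assms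
  show "(x, y) \<in> far_chains X E' F'" unfolding far_chains_def by auto
qed

lemma far_chains_Times: "far_chains X E F \<subseteq> pts X \<times> pts X"
  by (auto simp: far_chains_def dest: E_chain_in)

lemma far_chains_comp: "far_chains X E F O far_chains X E F \<subseteq> far_chains X E F"
  by (auto simp: far_chains_def elim: E_chain_trans)

lemma far_chains_converse: "(far_chains X E F)\<inverse> \<subseteq> far_chains X (E\<inverse>) F"
  by (auto simp: far_chains_def dest: E_chain_converse)

text \<open>The preimage of a bounded set has bounded index differences, hence lies in an initial
  segment. The relation of consecutive indices is controlled with constant 1, so its image collects
  all steps of \<open>s\<close> in one controlled set.\<close>

lemma
  assumes "s \<in> coarse_seqs X" "pointed_coarse_space X"
  shows coarse_seqs_pts: "s n \<in> pts X"
    and coarse_seqs_proper: "cbounded X B \<Longrightarrow> \<exists>N. \<forall>i\<ge>N. s i \<notin> B"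
    and coarse_seqs_steps: "{(s i, s (Suc i)) | i. True} \<in> ctrl X"
proof -
  have s: "pointed_coarse_map nat_space X s" using assms unfolding coarse_seqs_def by simp
  show "s n \<in> pts X" using s unfolding pointed_coarse_map_def nat_space_def by auto
  show "\<exists>N. \<forall>i\<ge>N. s i \<notin> B" if "cbounded X B"
  proof -
    let ?P = "{i. s i \<in> B}"
    have "cbounded nat_space ?P"
      using s that unfolding pointed_coarse_map_def proper_def by (auto simp: nat_space_def)
    then obtain k where k: "\<And>i j. s i \<in> B \<Longrightarrow> s j \<in> B \<Longrightarrow> \<bar>int i - int j\<bar> \<le> k"
      unfolding cbounded_def nat_space_def by auto
    show ?thesis
    proof (cases "?P = {}")
      case False
      then obtain j where j: "s j \<in> B" by blast
      \<comment> \<open>Such an \<open>i\<close> exceeds \<open>j\<close> by more than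
        \<open>k\<close>, so both cannot lie in the preimage.\<close>
      have "s i \<notin> B" if "i \<ge> Suc (j + nat k)" for i
        using k[OF _ j, of i] that by (cases "s i \<in> B") auto
      then show ?thesis by blast
    qed auto
  qed
  have "{(i, Suc i) | i. True} \<in> ctrl nat_space"
    unfolding nat_space_def by (auto intro!: exI[of _ 1])
  then have "map_prod s s ` {(i, Suc i) | i. True} \<in> ctrl X"
    using s unfolding pointed_coarse_map_def bornologous_def by blast
  also have "map_prod s s ` {(i, Suc i) | i. True} = {(s i, s (Suc i)) | i. True}" by auto
  finally show "{(s i, s (Suc i)) | i. True} \<in> ctrl X" .
qed

lemma coarse_seqs_compose:
  assumes "s \<in> coarse_seqs X" "pointed_coarse_map X Y f" "pointed_coarse_space X"
  shows "f \<circ> s \<in> coarse_seqs Y"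
proof -
  have s: "pointed_coarse_map nat_space X s" using assms unfolding coarse_seqs_def by simp
  have "{n. f (s n) \<in> B} = {n \<in> pts nat_space. s n \<in> {x \<in> pts X. f x \<in> B}}" for B
    using coarse_seqs_pts[OF assms(1,3)] by (auto simp: nat_space_def)
  moreover have "map_prod (f \<circ> s) (f \<circ> s) ` E = map_prod f f ` map_prod s s ` E" for E
    by (simp add: image_image map_prod_def case_prod_unfold)
  ultimately have "pointed_coarse_map nat_space Y (f \<circ> s)"
    using s assms(2) unfolding pointed_coarse_map_def proper_def bornologous_def
    by (auto simp: nat_space_def)
  then show ?thesis unfolding coarse_seqs_def by simp
qed

text \<open>Tests the definition against the ball of \<open>F\<close>. A component is connected
  within itself and lies outside the ball, so tail points are joined for all \<open>i\<close> and
  \<open>j\<close> independently.\<close>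

lemma eps_rel_far_chains:
  assumes X: "pointed_coarse_space X" and st: "(s, t) \<in> eps_rel X"
  shows "\<exists>E\<in>ctrl X. \<forall>F\<in>ctrl X. \<exists>N. \<forall>i\<ge>N. \<forall>j\<ge>N. (s i, t j) \<in> far_chains X E F"
proof -
  obtain E where E: "E \<in> ctrl X" and K: "\<forall>B. cbounded X B \<and> base X \<in> B \<longrightarrow>
      (\<exists>N K. E_component E (pts X - B) K \<and> s ` {N..} \<subseteq> K \<and> t ` {N..} \<subseteq> K)"
    using st unfolding eps_rel_def by auto
  have "\<exists>N. \<forall>i\<ge>N. \<forall>j\<ge>N. (s i, t j) \<in> far_chains X E F" if F: "F \<in> ctrl X" for F
  proof -
    let ?B = "insert (base X) {z \<in> pts X. (z, base X) \<in> F}"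
    obtain N K where NK: "E_component E (pts X - ?B) K" "s ` {N..} \<subseteq> K" "t ` {N..} \<subseteq> K"
      using K[rule_format, of ?B] cbounded_ball[OF X F] by auto
    have "(s i, t j) \<in> far_chains X E F" if "i \<ge> N" "j \<ge> N" for i j
    proof -
      have "s i \<in> K" "t j \<in> K" using NK that by auto
      then have "E_chain E K (s i) (t j)"
        using NK(1) unfolding E_component_def E_connected_def by simp
      moreover have "K \<subseteq> pts X - ?B" using NK(1) unfolding E_component_def by blast
      ultimately have "E_chain E {z \<in> pts X. (z, base X) \<notin> F} (s i) (t j)"
        using E_chain_mono[of E K "s i" "t j" id E "{z \<in> pts X. (z, base X) \<notin> F}"] by auto
      then show ?thesis unfolding far_chains_def by simp
    qed
    then show ?thesis by blast
  qed
  then show ?thesis using E by blast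
qed

lemma eps_relI:
  assumes X: "pointed_coarse_space X" and s: "s \<in> coarse_seqs X" and t: "t \<in> coarse_seqs X"
    and E: "E \<in> ctrl X"
    and ex: "\<And>F N. F \<in> ctrl X \<Longrightarrow> \<exists>i\<ge>N. \<exists>j\<ge>N. (s i, t j) \<in> far_chains X E F"
  shows "(s, t) \<in> eps_rel X"
proof -
  let ?S = "{(s i, s (Suc i)) | i. True}" and ?T = "{(t i, t (Suc i)) | i. True}"
  \<comment> \<open>The steps of \<open>s\<close> and \<open>t\<close> connect each tail, and the
    converse in \<open>H\<close> gives the symmetry that \<open>E_component_of_sym\<close> asks for.
    \<open>H\<close> is fixed before \<open>B\<close>, as the order of quantifiers in
    \<open>eps_rel\<close> demands.\<close>
  define G where "G = E \<union> ?S \<union> ?T"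
  define H where "H = G \<union> G\<inverse>"
  have "G \<in> ctrl X"
    unfolding G_def using ctrl_Un[OF X] E coarse_seqs_steps[OF s X] coarse_seqs_steps[OF t X] by simp
  then have H: "H \<in> ctrl X" unfolding H_def using ctrl_Un[OF X] ctrl_converse[OF X] by simp
  have symH: "sym H" unfolding H_def by (auto simp: sym_def)
  have "\<exists>N K. E_component H (pts X - B) K \<and> s ` {N..} \<subseteq> K \<and> t ` {N..} \<subseteq> K"
    if B: "cbounded X B" "base X \<in> B" for B
  proof -
    let ?A = "pts X - B"
    obtain N1 N2 where N12: "\<And>i. i \<ge> N1 \<Longrightarrow> s i \<notin> B" "\<And>i. i \<ge> N2 \<Longrightarrow> t i \<notin> B"
      using coarse_seqs_proper[OF s X B(1)] coarse_seqs_proper[OF t X B(1)] by blast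
    define N where "N = max N1 N2"
    have N: "s i \<in> ?A" "t i \<in> ?A" if "i \<ge> N" for i
      using that N12 coarse_seqs_pts[OF s X] coarse_seqs_pts[OF t X] unfolding N_def by auto
    have "(s i, s (Suc i)) \<in> H" "(t i, t (Suc i)) \<in> H" for i
      unfolding H_def G_def by auto
    then have tails: "E_chain H ?A (s N) (s i)" "E_chain H ?A (t N) (t i)" if "i \<ge> N" for i
      using E_chain_interval[of N s ?A H N i] E_chain_interval[of N t ?A H N i] N that by auto
    have rev: "E_chain H ?A v u" if "E_chain H ?A u v" for u v
      using E_chain_converse[OF that] symH by (simp add: sym_conv_converse_eq)
    \<comment> \<open>The ball of \<open>B \<times> {base X}\<close> is \<open>B\<close> itself, so
      the chain obtained from \<open>ex\<close> avoids \<open>B\<close>.\<close>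
    have "B \<times> {base X} \<in> ctrl X"
      using B unfolding cbounded_def by (auto intro: ctrl_subset[OF X, of "B \<times> B"])
    then obtain i j where ij: "i \<ge> N" "j \<ge> N" "(s i, t j) \<in> far_chains X E (B \<times> {base X})"
      using ex by blast
    have "E_chain H ?A (s i) (t j)"
      using E_chain_mono[of E "{z \<in> pts X. (z, base X) \<notin> B \<times> {base X}}" "s i" "t j" id H ?A] ij(3)
      unfolding far_chains_def H_def G_def by auto
    then have "E_chain H ?A (s N) (t N)"
      using tails(1)[OF ij(1)] rev[OF tails(2)[OF ij(2)]] E_chain_trans by metis
    then have "t ` {N..} \<subseteq> {y. E_chain H ?A (s N) y}" "s ` {N..} \<subseteq> {y. E_chain H ?A (s N) y}"
      by (auto intro: E_chain_trans tails)
    moreover have "E_component H ?A {y. E_chain H ?A (s N) y}"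
      using E_component_of_sym[OF symH] N(1) by blast
    ultimately show ?thesis by blast
  qed
  then show ?thesis unfolding eps_rel_def using s t H by blast
qed

text \<open>Properness makes the preimage of the ball of \<open>F\<close> bounded, and a chain that
  avoids this preimage maps to a chain that avoids the ball. \<open>G\<close> does not depend on
  \<open>E\<close>.\<close>

lemma far_chains_map:
  assumes X: "pointed_coarse_space X" and Y: "pointed_coarse_space Y"
    and f: "pointed_coarse_map X Y f" and F: "F \<in> ctrl Y"
  shows "\<exists>G\<in>ctrl X. \<forall>E. map_prod f f ` far_chains X E G \<subseteq> far_chains Y (map_prod f f ` E) F"
proof
  \<comment> \<open>Adding the basepoint to the ball puts \<open>base X\<close> into
    \<open>?B\<close>, so that \<open>?B \<times> {base X}\<close> is a subset of the controlled set
    \<open>?B \<times> ?B\<close>.\<close>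
  let ?B = "{x \<in> pts X. f x \<in> insert (base Y) {z \<in> pts Y. (z, base Y) \<in> F}}"
  have "cbounded X ?B"
    using f cbounded_ball[OF Y F] unfolding pointed_coarse_map_def proper_def by blast
  moreover have base: "base X \<in> ?B"
    using f base_in_pts[OF X] unfolding pointed_coarse_map_def by simp
  ultimately show "?B \<times> {base X} \<in> ctrl X"
    unfolding cbounded_def by (auto intro: ctrl_subset[OF X, of "?B \<times> ?B"])
  show "\<forall>E. map_prod f f ` far_chains X E (?B \<times> {base X}) \<subseteq> far_chains Y (map_prod f f ` E) F"
  proof (intro allI image_subsetI)
    fix E p assume "p \<in> far_chains X E (?B \<times> {base X})"
    then obtain x y where p: "p = (x, y)"
      and ch: "E_chain E {z \<in> pts X. (z, base X) \<notin> ?B \<times> {base X}} x y"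
      unfolding far_chains_def by auto
    have "E_chain (map_prod f f ` E) {z \<in> pts Y. (z, base Y) \<notin> F} (f x) (f y)"
    proof (rule E_chain_mono[OF ch])
      show "(f u, f v) \<in> map_prod f f ` E" if "(u, v) \<in> E" for u v using that by force
      show "f u \<in> {z \<in> pts Y. (z, base Y) \<notin> F}"
        if "u \<in> {z \<in> pts X. (z, base X) \<notin> ?B \<times> {base X}}" for u
        using that f unfolding pointed_coarse_map_def by auto
    qed
    then show "map_prod f f p \<in> far_chains Y (map_prod f f ` E) F"
      unfolding p far_chains_def by simp
  qed
qed

section \<open>The comparison map\<close>

context nonstandard_universe
begin

text \<open>The set of codes of controlled sets is the index set for saturation.\<close>

definition standard_space :: "'u pcoarse \<Rightarrow> bool" where
  "standard_space X \<longleftrightarrow>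
     pointed_coarse_space X \<and> is_set (pts X) \<and> is_set (rel_code mem ` ctrl X)"

lemma is_rel_ctrl: "standard_space X \<Longrightarrow> E \<in> ctrl X \<Longrightarrow> is_rel E"
  unfolding standard_space_def by (meson is_relI ctrl_Times)

lemma is_rel_far_chains: "standard_space X \<Longrightarrow> is_rel (far_chains X E F)"
  unfolding standard_space_def by (meson is_relI far_chains_Times)

lemma inf_pts_iff:
  "x \<in> inf_pts mem smem star X \<longleftrightarrow>
    smem x (star (set_code mem (pts X))) \<and> (\<forall>F\<in>ctrl X. (x, star (base X)) \<notin> srel F)"
  unfolding inf_pts_def sim_def by (simp add: sset_iff)

text \<open>The transfer of \<open>E_chain_iff_is_chain\<close>: in the extension, the codes
  \<open>c\<close> are internal hyperfinite chains.\<close>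

lemma srel_far_chains_iff:
  assumes X: "standard_space X" and E: "E \<in> ctrl X" and F: "F \<in> ctrl X"
  shows "(x, y) \<in> srel (far_chains X E F) \<longleftrightarrow>
    (\<exists>c n. is_chain smem (star nums) (star (set_code mem (pts X))) (star (rel_code mem E))
      (star (rel_code mem F)) (star (base X)) c n x y)"
proof -
  let ?v = "[rel_code mem (far_chains X E F), nums, set_code mem (pts X), rel_code mem E,
    rel_code mem F, base X]"
  have A: "is_set (pts X)" using X unfolding standard_space_def by simp
  have "\<forall>x y. (x, y) \<in> rel_of mem (rel_code mem (far_chains X E F)) \<longleftrightarrow>
    (\<exists>c n. is_chain mem nums (set_code mem (pts X)) (rel_code mem E) (rel_code mem F) (base X) c n x y)"
    unfolding rel_of_rel_code[OF is_rel_far_chains[OF X]]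
    using E_chain_iff_is_chain[OF A is_rel_ctrl[OF X E] is_rel_ctrl[OF X F]]
    by (simp add: far_chains_def)
  moreover have "dfn 6
    (\<lambda>v. \<forall>x y. (x, y) \<in> rel_of mem (v 0) \<longleftrightarrow>
      (\<exists>c n. is_chain mem (v 1) (v 2) (v 3) (v 4) (v 5) c n x y))
    (\<lambda>v. \<forall>x y. (x, y) \<in> rel_of smem (v 0) \<longleftrightarrow>
      (\<exists>c n. is_chain smem (v 1) (v 2) (v 3) (v 4) (v 5) c n x y))"
    by (intro dfn_intros; simp)
  note dfn_transfer[OF this, of "(!) ?v"]
  ultimately have "\<forall>x y. (x, y) \<in> rel_of smem (star (rel_code mem (far_chains X E F))) \<longleftrightarrow>
    (\<exists>c n. is_chain smem (star nums) (star (set_code mem (pts X))) (star (rel_code mem E))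
      (star (rel_code mem F)) (star (base X)) c n x y)"
    by simp
  then show ?thesis unfolding star_rel_def by blast
qed

section \<open>Saturation and hyperfinite chains\<close>

text \<open>Finitely many controlled sets have a controlled union \<open>G\<close>, so a witness for
  all \<open>F \<subseteq> G\<close> meets any finite part of the family.\<close>

lemma saturated_ctrl:
  assumes X: "standard_space X"
    and ex: "\<And>G. G \<in> ctrl X \<Longrightarrow> \<exists>y. \<forall>F\<in>ctrl X. F \<subseteq> G \<longrightarrow> smem y (H (rel_code mem F))"
  shows "\<exists>y. \<forall>F\<in>ctrl X. smem y (H (rel_code mem F))"
proof -
  obtain I where I: "ext mem I = rel_code mem ` ctrl X"
    using X unfolding standard_space_def is_set_def by blast
  have "\<exists>y. \<forall>j\<in>ext mem I. y \<in> ext smem (H j)"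
  proof (rule saturated)
    fix J assume "finite J" "J \<subseteq> ext mem I"
    then obtain J' where J': "J' \<subseteq> ctrl X" "finite J'" "J = rel_code mem ` J'"
      using finite_subset_image[of J "rel_code mem" "ctrl X"] I by auto
    have "\<Union>J' \<in> ctrl X"
      using ctrl_finite_Un J'(1,2) X unfolding standard_space_def by blast
    from ex[OF this] obtain y where y: "\<forall>F\<in>ctrl X. F \<subseteq> \<Union>J' \<longrightarrow> smem y (H (rel_code mem F))"
      by blast
    have "y \<in> ext smem (H j)" if "j \<in> J" for j
      using that y J'(1,3) by (auto simp: ext_def)
    then show "\<exists>y. \<forall>j\<in>J. y \<in> ext smem (H j)" by blast
  qed
  then show ?thesis unfolding I by (auto simp: ext_def)
qed

text \<open>Saturation needs each condition on a chain code to be an internal set. Separation inside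
  the bound of \<open>chain_bound\<close> gives this set in the universe, and transfer carries it
  over.\<close>

lemma internal_chains:
  assumes X: "standard_space X" and E: "E \<in> ctrl X"
  shows "\<exists>H. \<forall>F\<in>ctrl X. \<forall>c. smem c (H (rel_code mem F)) \<longleftrightarrow>
    (\<exists>n. is_chain smem (star nums) (star (set_code mem (pts X))) (star (rel_code mem E))
      (star (rel_code mem F)) (star (base X)) c n x y)"
proof -
  have A: "is_set (pts X)" using X unfolding standard_space_def by simp
  obtain K where K: "\<forall>E F b c n x y. is_chain mem nums (set_code mem (pts X)) E F b c n x y \<longrightarrow> mem c K"
    using chain_bound[OF A] by blast
  have "\<exists>h. \<forall>c. mem c h \<longleftrightarrow>
      (\<exists>n. is_chain mem nums (set_code mem (pts X)) (rel_code mem E) r (base X) c n x y)" for r x y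
    using separation[of K "\<lambda>c. \<exists>n. is_chain mem nums (set_code mem (pts X)) (rel_code mem E) r (base X) c n x y"] K
    by meson
  then have "\<forall>x y. \<exists>h. \<forall>c. mem c h \<longleftrightarrow>
      (\<exists>n. is_chain mem nums (set_code mem (pts X)) (rel_code mem E) r (base X) c n x y)" for r
    by blast
  \<comment> \<open>The points \<open>x\<close> and \<open>y\<close> of the extension need not be
    standard, so they are quantified inside the formula; the valuation carries standard parameters
    only.\<close>
  moreover have "dfn 5
    (\<lambda>v. \<forall>x y. \<exists>h. \<forall>c. mem c h \<longleftrightarrow> (\<exists>n. is_chain mem (v 0) (v 1) (v 2) (v 3) (v 4) c n x y))
    (\<lambda>v. \<forall>x y. \<exists>h. \<forall>c. smem c h \<longleftrightarrow> (\<exists>n. is_chain smem (v 0) (v 1) (v 2) (v 3) (v 4) c n x y))"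
    by (intro dfn_intros; simp)
  note dfn_transfer[OF this, of "(!) [nums, set_code mem (pts X), rel_code mem E, r, base X]" for r]
  ultimately have "\<forall>x y. \<exists>h. \<forall>c. smem c h \<longleftrightarrow>
      (\<exists>n. is_chain smem (star nums) (star (set_code mem (pts X))) (star (rel_code mem E))
        (star r) (star (base X)) c n x y)" for r
    by simp
  then have "\<forall>r. \<exists>h. \<forall>c. smem c h \<longleftrightarrow>
      (\<exists>n. is_chain smem (star nums) (star (set_code mem (pts X))) (star (rel_code mem E))
        (star r) (star (base X)) c n x y)"
    by blast
  then have "\<exists>H. \<forall>r c. smem c (H r) \<longleftrightarrow>
      (\<exists>n. is_chain smem (star nums) (star (set_code mem (pts X))) (star (rel_code mem E))
        (star r) (star (base X)) c n x y)"
    by (rule choice)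
  then show ?thesis by blast
qed

text \<open>Saturation selects the code \<open>c\<close> alone, which leaves a length for each
  \<open>F\<close>. The lengths agree because \<open>c\<close> determines its domain, and the domain
  its last index.\<close>

lemma uniform_chain:
  assumes X: "standard_space X" and E: "E \<in> ctrl X"
    and xy: "\<And>F. F \<in> ctrl X \<Longrightarrow> (x, y) \<in> srel (far_chains X E F)"
  shows "\<exists>c n. \<forall>F\<in>ctrl X. is_chain smem (star nums) (star (set_code mem (pts X)))
    (star (rel_code mem E)) (star (rel_code mem F)) (star (base X)) c n x y"
proof -
  let ?ch = "\<lambda>F. is_chain smem (star nums) (star (set_code mem (pts X)))
    (star (rel_code mem E)) (star (rel_code mem F)) (star (base X))"
  obtain H where H: "\<forall>F\<in>ctrl X. \<forall>c. smem c (H (rel_code mem F)) \<longleftrightarrow> (\<exists>n. ?ch F c n x y)"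
    using internal_chains[OF X E, of x y] by auto
  have "\<exists>c. \<forall>F\<in>ctrl X. smem c (H (rel_code mem F))"
  proof (rule saturated_ctrl[OF X])
    fix G assume G: "G \<in> ctrl X"
    with xy[OF G] obtain c n where c: "?ch G c n x y"
      using srel_far_chains_iff[OF X E G, of x y] by auto
    have "smem c (H (rel_code mem F))" if F: "F \<in> ctrl X" "F \<subseteq> G" for F
    proof -
      have "?ch F c n x y"
        by (rule is_chain_mono[OF c order_refl srel_mono[OF is_rel_ctrl[OF X G] F(2), unfolded star_rel_def]])
      then show ?thesis using H F(1) by auto
    qed
    then show "\<exists>c. \<forall>F\<in>ctrl X. F \<subseteq> G \<longrightarrow> smem c (H (rel_code mem F))" by auto
  qed
  then obtain c where "\<forall>F\<in>ctrl X. smem c (H (rel_code mem F))" by auto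
  then have c: "\<forall>F\<in>ctrl X. \<exists>n. ?ch F c n x y" using H by simp
  obtain n where n: "?ch E c n x y" using bspec[OF c E] by auto
  have "?ch F c n x y" if "F \<in> ctrl X" for F
  proof -
    obtain m where m: "?ch F c m x y" using bspec[OF c \<open>F \<in> ctrl X\<close>] by auto
    have "n = m"
    proof (rule upto_num_inject)
      show "smem n (star nums)" "smem m (star nums)" using n m unfolding is_chain_def by simp_all
      show "upto_num smem (star nums) n = upto_num smem (star nums) m"
        by (rule is_fun_domain_unique[of smem c]) (use n m in \<open>simp_all add: is_chain_def\<close>)
    qed
    then show ?thesis using m by simp
  qed
  then show ?thesis by auto
qed

lemma iota_rel_iff:
  "(x, y) \<in> iota_rel mem smem star X \<longleftrightarrow>
    x \<in> inf_pts mem smem star X \<and> y \<in> inf_pts mem smem star X \<and>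
    (\<exists>n c. smem n (star nums) \<and> is_fun smem c (upto_num smem (star nums) n) \<and>
      (\<forall>i\<in>upto_num smem (star nums) n. app smem c i \<in> inf_pts mem smem star X) \<and>
      app smem c (star (num mem 0)) = x \<and> app smem c n = y \<and>
      (\<forall>i. smem i (star nums) \<and> smem i n \<longrightarrow>
        sim mem smem star X (app smem c i) (app smem c (succ smem i))))"
  unfolding iota_rel_def by (simp add: Bex_def Ball_def star_nat_iff imp_conjL)

text \<open>An internal chain that avoids all standard balls has its values in
  \<open>inf_pts\<close>, and steps in the star of one standard \<open>E\<close> are instances of
  \<open>sim\<close>.\<close>

lemma iota_relI:
  assumes X: "standard_space X" and E: "E \<in> ctrl X"
    and xy: "\<And>F. F \<in> ctrl X \<Longrightarrow> (x, y) \<in> srel (far_chains X E F)"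
  shows "(x, y) \<in> iota_rel mem smem star X"
proof -
  obtain c n where c: "\<And>F. F \<in> ctrl X \<Longrightarrow> is_chain smem (star nums) (star (set_code mem (pts X)))
      (star (rel_code mem E)) (star (rel_code mem F)) (star (base X)) c n x y"
    using uniform_chain[OF assms] by blast
  let ?D = "upto_num smem (star nums) n"
  have n: "smem n (star nums)" and f: "is_fun smem c ?D"
    using c[OF E] unfolding is_chain_def by simp_all
  have inf: "app smem c i \<in> inf_pts mem smem star X" if "i \<in> ?D" for i
  proof -
    have "smem (app smem c i) (star (set_code mem (pts X))) \<and> (app smem c i, star (base X)) \<notin> srel F"
      if "F \<in> ctrl X" for F
      using is_chain_value[OF c[OF that] _ _ app_rel[OF f \<open>i \<in> ?D\<close>]] \<open>i \<in> ?D\<close>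
      unfolding star_rel_def by simp
    then show ?thesis unfolding inf_pts_iff using E by blast
  qed
  have n_in: "n \<in> ?D" using n by simp
  have "app smem c n = y"
    using app_eqI[OF f n_in] c[OF E] unfolding is_chain_def by simp
  moreover have "app smem c (star (num mem 0)) = x"
  proof -
    obtain z where "ext smem z = {}" "(z, x) \<in> rel_of smem c"
      using c[OF E] unfolding is_chain_def by blast
    then show ?thesis using app_eqI[OF f star_0_in[OF n]] star_0_unique by simp
  qed
  moreover have "sim mem smem star X (app smem c i) (app smem c (succ smem i))"
    if "smem i (star nums)" "smem i n" for i
  proof -
    have "is_succ smem (succ smem i) i" "succ smem i \<in> ?D"
      using succ_in[OF that(1) n that(2)] by auto
    moreover have "(i, app smem c i) \<in> rel_of smem c"
      using app_rel[OF f] that by simp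
    moreover have "(succ smem i, app smem c (succ smem i)) \<in> rel_of smem c"
      using app_rel[OF f calculation(2)] .
    ultimately have "(app smem c i, app smem c (succ smem i)) \<in> srel E"
      unfolding star_rel_def by (intro is_chain_step[OF c[OF E] that])
    then show ?thesis unfolding sim_def using E by blast
  qed
  moreover have "x \<in> inf_pts mem smem star X" "y \<in> inf_pts mem smem star X"
    using inf[OF star_0_in[OF n]] inf[OF n_in] calculation(1,2) by simp_all
  ultimately show ?thesis
    unfolding iota_rel_iff using n f inf by blast
qed

text \<open>\<open>H r\<close> collects the indices whose step leaves the star of \<open>r\<close>,
  as an internal set to which saturation applies.\<close>

lemma internal_bad_steps:
  "\<exists>H. \<forall>r i. smem i (H r) \<longleftrightarrow> smem i (star nums) \<and> smem i n \<and>
    (\<exists>j u v. is_succ smem j i \<and> (i, u) \<in> rel_of smem c \<and> (j, v) \<in> rel_of smem c \<and>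
      (u, v) \<notin> rel_of smem (star r))"
proof (rule choice)
  have "dfn 2
    (\<lambda>v. \<forall>n c. \<exists>h. \<forall>i. mem i h \<longleftrightarrow> mem i (v 0) \<and> (mem i n \<and>
      (\<exists>j x y. is_succ mem j i \<and> (i, x) \<in> rel_of mem c \<and> (j, y) \<in> rel_of mem c \<and>
        (x, y) \<notin> rel_of mem (v 1))))
    (\<lambda>v. \<forall>n c. \<exists>h. \<forall>i. smem i h \<longleftrightarrow> smem i (v 0) \<and> (smem i n \<and>
      (\<exists>j x y. is_succ smem j i \<and> (i, x) \<in> rel_of smem c \<and> (j, y) \<in> rel_of smem c \<and>
        (x, y) \<notin> rel_of smem (v 1))))"
    by (intro dfn_intros; simp)
  from dfn_transfer[OF this, of "(!) [nums, r]" for r]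
  have "\<forall>n c. \<exists>h. \<forall>i. smem i h \<longleftrightarrow> smem i (star nums) \<and> smem i n \<and>
    (\<exists>j u v. is_succ smem j i \<and> (i, u) \<in> rel_of smem c \<and> (j, v) \<in> rel_of smem c \<and>
      (u, v) \<notin> rel_of smem (star r))" for r
    by (simp add: separation)
  then show "\<forall>r. \<exists>h. \<forall>i. smem i h \<longleftrightarrow> smem i (star nums) \<and> smem i n \<and>
    (\<exists>j u v. is_succ smem j i \<and> (i, u) \<in> rel_of smem c \<and> (j, v) \<in> rel_of smem c \<and>
      (u, v) \<notin> rel_of smem (star r))" by blast
qed

text \<open>If every standard \<open>E\<close> missed some step, the sets of missed indices would be
  internal, nonempty and decreasing in \<open>E\<close>. Saturation would then give one index whose
  step is missed by all \<open>E\<close>, against \<open>sim\<close> at this index.\<close>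

lemma iota_relD:
  assumes X: "standard_space X" and xy: "(x, y) \<in> iota_rel mem smem star X"
  shows "\<exists>E\<in>ctrl X. \<forall>F\<in>ctrl X. (x, y) \<in> srel (far_chains X E F)"
proof -
  obtain n c where n: "smem n (star nums)" and f: "is_fun smem c (upto_num smem (star nums) n)"
    and inf: "\<forall>i\<in>upto_num smem (star nums) n. app smem c i \<in> inf_pts mem smem star X"
    and c0: "app smem c (star (num mem 0)) = x" and cn: "app smem c n = y"
    and step: "\<forall>i. smem i (star nums) \<and> smem i n \<longrightarrow>
      sim mem smem star X (app smem c i) (app smem c (succ smem i))"
    using xy unfolding iota_rel_iff by auto
  obtain H where H: "\<And>r i. smem i (H r) \<longleftrightarrow> smem i (star nums) \<and> smem i n \<and>
    (\<exists>j u v. is_succ smem j i \<and> (i, u) \<in> rel_of smem c \<and> (j, v) \<in> rel_of smem c \<and>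
      (u, v) \<notin> rel_of smem (star r))"
    using internal_bad_steps[of n c] by auto
  have "\<exists>E\<in>ctrl X. \<forall>i. \<not> smem i (H (rel_code mem E))"
  proof (rule ccontr)
    assume "\<not> ?thesis"
    then have bad: "\<exists>i. smem i (H (rel_code mem E))" if "E \<in> ctrl X" for E using that by blast
    have "\<exists>i. \<forall>E\<in>ctrl X. smem i (H (rel_code mem E))"
    proof (rule saturated_ctrl[OF X])
      fix G assume G: "G \<in> ctrl X"
      obtain i where i: "smem i (H (rel_code mem G))" using bad[OF G] by blast
      have "smem i (H (rel_code mem E))" if "E \<subseteq> G" for E
        using i srel_mono[OF is_rel_ctrl[OF X G] that] unfolding H star_rel_def by blast
      then show "\<exists>i. \<forall>E\<in>ctrl X. E \<subseteq> G \<longrightarrow> smem i (H (rel_code mem E))" by blast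
    qed
    then obtain i where i: "\<And>E. E \<in> ctrl X \<Longrightarrow> smem i (H (rel_code mem E))" by blast
    \<comment> \<open>Some controlled set is required here to extract from \<open>i\<close> that the
      index lies below \<open>n\<close>.\<close>
    have "Id_on (pts X) \<in> ctrl X" using X ctrl_Id_on unfolding standard_space_def by blast
    then have i_in: "smem i (star nums)" "smem i n" using i H by blast+
    then obtain E where E: "E \<in> ctrl X" "(app smem c i, app smem c (succ smem i)) \<in> srel E"
      using step unfolding sim_def by blast
    obtain j u v where j: "is_succ smem j i" "(i, u) \<in> rel_of smem c" "(j, v) \<in> rel_of smem c"
      "(u, v) \<notin> srel E"
      using i[OF E(1)] unfolding H star_rel_def by blast
    have "app smem c i = u" using app_eqI[OF f _ j(2)] i_in by simp
    moreover have "app smem c (succ smem i) = v"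
      using app_eqI[OF f _ j(3)] succ_in[OF i_in(1) n i_in(2)] succ_eq[OF j(1)] by simp
    ultimately show False using E(2) j(4) by simp
  qed
  then obtain E where E: "E \<in> ctrl X" and good: "\<And>i. \<not> smem i (H (rel_code mem E))" by blast
  have "(x, y) \<in> srel (far_chains X E F)" if F: "F \<in> ctrl X" for F
  proof -
    have "(star (num mem 0), x) \<in> rel_of smem c"
      using app_rel[OF f star_0_in[OF n]] c0 by simp
    moreover have "(n, y) \<in> rel_of smem c" using app_rel[OF f, of n] n cn by simp
    moreover have "smem z (star (set_code mem (pts X))) \<and> (z, star (base X)) \<notin> rel_of smem (star (rel_code mem F))"
      if "smem i (star nums)" "smem i n \<or> i = n" "(i, z) \<in> rel_of smem c" for i z
    proof -
      have "app smem c i = z" using app_eqI[OF f _ that(3)] that by simp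
      then have "z \<in> inf_pts mem smem star X" using inf that by blast
      then show ?thesis using F unfolding inf_pts_iff star_rel_def by blast
    qed
    moreover have "(u, v) \<in> rel_of smem (star (rel_code mem E))"
      if "smem i (star nums)" "smem i n" "is_succ smem j i"
        "(i, u) \<in> rel_of smem c" "(j, v) \<in> rel_of smem c" for i j u v
      using good[of i] that unfolding H by blast
    ultimately have "is_chain smem (star nums) (star (set_code mem (pts X))) (star (rel_code mem E))
        (star (rel_code mem F)) (star (base X)) c n x y"
      unfolding is_chain_def using n f ext_star_0 by blast
    then show ?thesis using srel_far_chains_iff[OF X E F] by blast
  qed
  then show ?thesis using E by blast
qed

section \<open>Values of coarse sequences at infinite indices\<close>

abbreviation inf_nat :: "'v set" where "inf_nat \<equiv> infinite_nat mem smem star"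
abbreviation sseq :: "(nat \<Rightarrow> 'u) \<Rightarrow> 'v \<Rightarrow> 'v" where "sseq \<equiv> star_seq mem smem star"
abbreviation iota_eq :: "'u pcoarse \<Rightarrow> ('v \<times> 'v) set" where "iota_eq \<equiv> iota_rel mem smem star"

definition seq_graph :: "(nat \<Rightarrow> 'u) \<Rightarrow> ('u \<times> 'u) set" where
  "seq_graph s = range (\<lambda>n. (num mem n, s n))"

lemma standard_spaceD:
  assumes "standard_space X"
  shows "pointed_coarse_space X" and "is_set (pts X)"
  using assms unfolding standard_space_def by auto

lemma is_rel_seq_graph: "is_set A \<Longrightarrow> range s \<subseteq> A \<Longrightarrow> is_rel (seq_graph s)"
  by (rule is_relI[OF is_set_nums]) (auto simp: seq_graph_def)

lemma sseq_graph_iff: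
  assumes "is_set A" "range s \<subseteq> A" "i \<in> inf_nat"
  shows "(i, y) \<in> srel (seq_graph s) \<longleftrightarrow> y = sseq s i"
proof -
  have inj: "inj (num mem)" by (simp add: inj_def)
  \<comment> \<open>Turns the sequence into a function on the set of numerals, as
    \<open>srel_graph\<close> expects.\<close>
  let ?f = "s \<circ> inv (num mem)"
  have eq: "seq_graph s = (\<lambda>a. (a, ?f a)) ` range (num mem)"
    unfolding seq_graph_def image_image by (simp add: inv_f_f[OF inj])
  have "i \<in> sset (range (num mem))"
    using assms(3) unfolding infinite_nat_def star_nat_def by blast
  moreover have "?f \<in> range (num mem) \<rightarrow> A" using assms(2) by auto
  ultimately have "(i, y) \<in> srel (seq_graph s) \<longleftrightarrow> y = app smem (star (rel_code mem (seq_graph s))) i"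
    using srel_graph[OF is_set_nums assms(1), of ?f i y] unfolding eq by simp
  then show ?thesis unfolding star_seq_def seq_graph_def .
qed

lemma sseq_graph:
  "is_set A \<Longrightarrow> range s \<subseteq> A \<Longrightarrow> i \<in> inf_nat \<Longrightarrow> (i, sseq s i) \<in> srel (seq_graph s)"
  by (simp add: sseq_graph_iff)

text \<open>With \<open>T\<close> the numerals from \<open>N\<close> on, the assumption on tails
  says that the composite of \<open>(seq_graph s)\<inverse>\<close>, \<open>T \<times> T\<close> and
  \<open>seq_graph t\<close> lies in \<open>R\<close>. Infinite indices lie in the star of
  \<open>T\<close>.\<close>

lemma sseq_srelI:
  assumes A: "is_set A" and s: "range s \<subseteq> A" and t: "range t \<subseteq> A" and R: "is_rel R"
    and st: "\<And>i j. i \<ge> N \<Longrightarrow> j \<ge> N \<Longrightarrow> (s i, t j) \<in> R"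
    and ij: "i \<in> inf_nat" "j \<in> inf_nat"
  shows "(sseq s i, sseq t j) \<in> srel R"
proof -
  let ?T = "num mem ` {N..}"
  have T: "is_set ?T" by (rule is_set_num_image)
  have rel: "is_rel (seq_graph s)" "is_rel (seq_graph t)" "is_rel (?T \<times> ?T)"
    using is_rel_seq_graph[OF A] s t is_rel_Times[OF T T] by auto
  have "(i, j) \<in> srel (?T \<times> ?T)" unfolding srel_Times[OF T T] using infinite_nat_tail ij by blast
  then have "(sseq s i, sseq t j) \<in> (srel (seq_graph s))\<inverse> O srel (?T \<times> ?T) O srel (seq_graph t)"
    using sseq_graph[OF A s ij(1)] sseq_graph[OF A t ij(2)] by blast
  also have "\<dots> = srel ((seq_graph s)\<inverse> O (?T \<times> ?T) O seq_graph t)"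
    using rel by (simp add: srel_comp srel_converse is_rel_comp is_rel_converse)
  also have "\<dots> \<subseteq> srel R"
    by (rule srel_mono[OF R]) (use st in \<open>auto simp: seq_graph_def\<close>)
  finally show ?thesis .
qed

text \<open>If there were no such indices, the pullback of \<open>R\<close> to the numerals from
  \<open>N\<close> on would be empty, yet its star contains \<open>(i, j)\<close>.\<close>

lemma sseq_srelD:
  assumes A: "is_set A" and s: "range s \<subseteq> A" and t: "range t \<subseteq> A" and R: "is_rel R"
    and ij: "i \<in> inf_nat" "j \<in> inf_nat" and st: "(sseq s i, sseq t j) \<in> srel R"
  shows "\<exists>i\<ge>N. \<exists>j\<ge>N. (s i, t j) \<in> R"
proof (rule ccontr)
  assume no: "\<not> ?thesis"
  let ?T = "num mem ` {N..}"
  have T: "is_set ?T" by (rule is_set_num_image)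
  have rel: "is_rel (seq_graph s)" "is_rel (seq_graph t)" "is_rel (Id_on ?T)"
    using is_rel_seq_graph[OF A] s t is_rel_Id_on[OF T] by auto
  have "(i, i) \<in> srel (Id_on ?T)" "(j, j) \<in> srel (Id_on ?T)"
    unfolding srel_Id_on[OF T] using infinite_nat_tail ij by blast+
  then have "(i, j) \<in> srel (Id_on ?T) O srel (seq_graph s) O srel R O (srel (seq_graph t))\<inverse> O srel (Id_on ?T)"
    using sseq_graph[OF A s ij(1)] sseq_graph[OF A t ij(2)] st by blast
  also have "\<dots> = srel (Id_on ?T O seq_graph s O R O (seq_graph t)\<inverse> O Id_on ?T)"
    using rel R by (simp add: srel_comp srel_converse is_rel_comp is_rel_converse)
  also have "Id_on ?T O seq_graph s O R O (seq_graph t)\<inverse> O Id_on ?T = {}"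
    using no by (auto simp: seq_graph_def)
  finally show False by (simp add: srel_empty)
qed

lemma range_coarse_seq: "standard_space X \<Longrightarrow> s \<in> coarse_seqs X \<Longrightarrow> range s \<subseteq> pts X"
  using coarse_seqs_pts standard_spaceD(1) by blast

lemma inf_pts_iff_sset:
  assumes X: "standard_space X"
  shows "x \<in> inf_pts mem smem star X \<longleftrightarrow> (\<forall>F\<in>ctrl X. x \<in> sset {z \<in> pts X. (z, base X) \<notin> F})"
proof -
  \<comment> \<open>With no controlled set, the condition for all \<open>F\<close> would not confine
    \<open>x\<close> to the star of \<open>pts X\<close>.\<close>
  have "ctrl X \<noteq> {}" using ctrl_Id_on[OF standard_spaceD(1)[OF X]] by blast
  moreover have "x \<in> sset {z \<in> pts X. (z, base X) \<notin> F} \<longleftrightarrow>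
      smem x (star (set_code mem (pts X))) \<and> (x, star (base X)) \<notin> srel F" if "F \<in> ctrl X" for F
    using sset_Collect_not_rel[OF standard_spaceD(2)[OF X] is_rel_ctrl[OF X that], of "base X"]
    by (simp add: sset_iff)
  ultimately show ?thesis unfolding inf_pts_iff by auto
qed

lemma sseq_in_inf_pts:
  assumes X: "standard_space X" and s: "s \<in> coarse_seqs X" and i: "i \<in> inf_nat"
  shows "sseq s i \<in> inf_pts mem smem star X"
  unfolding inf_pts_iff_sset[OF X]
proof
  fix F assume F: "F \<in> ctrl X"
  note X' = standard_spaceD[OF X]
  let ?D = "{z \<in> pts X. (z, base X) \<notin> F}"
  have D: "is_set ?D" by (rule is_set_subset[OF X'(2)]) auto
  obtain N where N: "\<forall>i\<ge>N. s i \<notin> insert (base X) {z \<in> pts X. (z, base X) \<in> F}"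
    using coarse_seqs_proper[OF s X'(1) cbounded_ball[OF X'(1) F]] by blast
  \<comment> \<open>\<open>sseq_srelI\<close> speaks of pairs, so the point is paired with
    itself.\<close>
  have "(sseq s i, sseq s i) \<in> srel (?D \<times> ?D)"
  proof (rule sseq_srelI[OF X'(2) _ _ is_rel_Times[OF D D] _ i i])
    show "range s \<subseteq> pts X" by (rule range_coarse_seq[OF X s])
    show "range s \<subseteq> pts X" by (rule range_coarse_seq[OF X s])
    show "(s i, s j) \<in> ?D \<times> ?D" if "i \<ge> N" "j \<ge> N" for i j
      using that N coarse_seqs_pts[OF s X'(1)] by auto
  qed
  then show "sseq s i \<in> sset ?D" unfolding srel_Times[OF D D] by simp
qed

text \<open>As \<open>i\<close> and \<open>j\<close> are independent, this covers a change of
  representative and of infinite index at once.\<close>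

lemma eps_rel_imp_iota_rel:
  assumes X: "standard_space X" and st: "(s, t) \<in> eps_rel X" and ij: "i \<in> inf_nat" "j \<in> inf_nat"
  shows "(sseq s i, sseq t j) \<in> iota_eq X"
proof -
  obtain E where E: "E \<in> ctrl X"
    "\<forall>F\<in>ctrl X. \<exists>N. \<forall>i\<ge>N. \<forall>j\<ge>N. (s i, t j) \<in> far_chains X E F"
    using eps_rel_far_chains[OF standard_spaceD(1)[OF X] st] by blast
  have s: "s \<in> coarse_seqs X" and t: "t \<in> coarse_seqs X" using st unfolding eps_rel_def by auto
  show ?thesis
  proof (rule iota_relI[OF X E(1)])
    fix F assume "F \<in> ctrl X"
    then obtain N where N: "\<forall>i\<ge>N. \<forall>j\<ge>N. (s i, t j) \<in> far_chains X E F" using E(2) by blast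
    show "(sseq s i, sseq t j) \<in> srel (far_chains X E F)"
      by (rule sseq_srelI[OF standard_spaceD(2)[OF X] range_coarse_seq[OF X s]
          range_coarse_seq[OF X t] is_rel_far_chains[OF X] _ ij, of N]) (use N in blast)
  qed
qed

text \<open>The source of injectivity: a single infinite pair suffices, since
  \<open>sseq_srelD\<close> finds standard indices beyond every \<open>N\<close>.\<close>

lemma iota_rel_imp_eps_rel:
  assumes X: "standard_space X" and s: "s \<in> coarse_seqs X" and t: "t \<in> coarse_seqs X"
    and ij: "i \<in> inf_nat" "j \<in> inf_nat" and st: "(sseq s i, sseq t j) \<in> iota_eq X"
  shows "(s, t) \<in> eps_rel X"
proof -
  obtain E where E: "E \<in> ctrl X" "\<forall>F\<in>ctrl X. (sseq s i, sseq t j) \<in> srel (far_chains X E F)"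
    using iota_relD[OF X st] by blast
  show ?thesis
  proof (rule eps_relI[OF standard_spaceD(1)[OF X] s t E(1)])
    fix F N assume "F \<in> ctrl X"
    then have "(sseq s i, sseq t j) \<in> srel (far_chains X E F)" using E(2) by blast
    then show "\<exists>i\<ge>N. \<exists>j\<ge>N. (s i, t j) \<in> far_chains X E F"
      by (rule sseq_srelD[OF standard_spaceD(2)[OF X] range_coarse_seq[OF X s]
          range_coarse_seq[OF X t] is_rel_far_chains[OF X] ij])
  qed
qed

section \<open>The equivalence relations and the value of \<open>omega'\<close> on a class\<close>

text \<open>\<open>iota_relD\<close> and \<open>iota_relI\<close> reduce the three laws to those of
  \<open>far_chains\<close>. For transitivity, the union of the two controlled sets brings both
  chains into one relation.\<close>

lemma equiv_iota_rel:
  assumes X: "standard_space X"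
  shows "equiv (inf_pts mem smem star X) (iota_eq X)"
proof (rule equivI)
  note X' = standard_spaceD[OF X]
  show "iota_eq X \<subseteq> inf_pts mem smem star X \<times> inf_pts mem smem star X"
    unfolding iota_rel_def by auto
  show "refl_on (inf_pts mem smem star X) (iota_eq X)"
  proof (rule refl_onI)
    fix x assume x: "x \<in> inf_pts mem smem star X"
    show "(x, x) \<in> iota_eq X"
    proof (rule iota_relI[OF X ctrl_Id_on[OF X'(1)]])
      fix F assume F: "F \<in> ctrl X"
      let ?D = "{z \<in> pts X. (z, base X) \<notin> F}"
      have D: "is_set ?D" by (rule is_set_subset[OF X'(2)]) auto
      have "(x, x) \<in> srel (Id_on ?D)"
        unfolding srel_Id_on[OF D] using x F unfolding inf_pts_iff_sset[OF X] by blast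
      moreover have "Id_on ?D \<subseteq> far_chains X (Id_on (pts X)) F"
        unfolding far_chains_def by (auto intro: E_chain_refl)
      ultimately show "(x, x) \<in> srel (far_chains X (Id_on (pts X)) F)"
        using srel_mono[OF is_rel_far_chains[OF X]] by blast
    qed
  qed
  show "sym (iota_eq X)"
  proof (rule symI)
    fix x y assume "(x, y) \<in> iota_eq X"
    then obtain E where E: "E \<in> ctrl X" "\<And>F. F \<in> ctrl X \<Longrightarrow> (x, y) \<in> srel (far_chains X E F)"
      using iota_relD[OF X] by blast
    show "(y, x) \<in> iota_eq X"
    proof (rule iota_relI[OF X ctrl_converse[OF X'(1) E(1)]])
      fix F assume "F \<in> ctrl X"
      then have "(y, x) \<in> srel ((far_chains X E F)\<inverse>)"
        using E(2) srel_converse[OF is_rel_far_chains[OF X]] by simp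
      then show "(y, x) \<in> srel (far_chains X (E\<inverse>) F)"
        using srel_mono[OF is_rel_far_chains[OF X] far_chains_converse] by blast
    qed
  qed
  show "trans (iota_eq X)"
  proof (rule transI)
    fix x y z assume "(x, y) \<in> iota_eq X" "(y, z) \<in> iota_eq X"
    then obtain E E' where E: "E \<in> ctrl X" "\<And>F. F \<in> ctrl X \<Longrightarrow> (x, y) \<in> srel (far_chains X E F)"
      and E': "E' \<in> ctrl X" "\<And>F. F \<in> ctrl X \<Longrightarrow> (y, z) \<in> srel (far_chains X E' F)"
      using iota_relD[OF X] by meson
    show "(x, z) \<in> iota_eq X"
    proof (rule iota_relI[OF X ctrl_Un[OF X'(1) E(1) E'(1)]])
      fix F assume F: "F \<in> ctrl X"
      let ?R = "far_chains X (E \<union> E') F"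
      have "(x, y) \<in> srel ?R" "(y, z) \<in> srel ?R"
        using E(2)[OF F] E'(2)[OF F]
          srel_mono[OF is_rel_far_chains[OF X] far_chains_mono[of _ "E \<union> E'" F F]] by blast+
      then have "(x, z) \<in> srel (?R O ?R)"
        unfolding srel_comp[OF is_rel_far_chains[OF X] is_rel_far_chains[OF X]] by blast
      then show "(x, z) \<in> srel ?R"
        using srel_mono[OF is_rel_far_chains[OF X] far_chains_comp] by blast
    qed
  qed
qed

text \<open>\<open>eps_rel\<close> is the pullback of \<open>iota_eq\<close> along evaluation at one
  fixed infinite index, so it inherits the laws.\<close>

lemma equiv_eps_rel:
  assumes X: "standard_space X"
  shows "equiv (coarse_seqs X) (eps_rel X)"
proof -
  obtain i where i: "i \<in> inf_nat" using infinite_nat_nonempty by blast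
  have iff: "(s, t) \<in> eps_rel X \<longleftrightarrow>
      s \<in> coarse_seqs X \<and> t \<in> coarse_seqs X \<and> (sseq s i, sseq t i) \<in> iota_eq X" for s t
    using eps_rel_imp_iota_rel[OF X _ i i, of s t] iota_rel_imp_eps_rel[OF X _ _ i i, of s t]
    by (auto simp: eps_rel_def)
  note eq = equiv_iota_rel[OF X]
  show ?thesis
  proof (rule equivI)
    show "eps_rel X \<subseteq> coarse_seqs X \<times> coarse_seqs X" using iff by auto
    show "refl_on (coarse_seqs X) (eps_rel X)"
    proof (rule refl_onI)
      fix s assume s: "s \<in> coarse_seqs X"
      have "refl_on (inf_pts mem smem star X) (iota_eq X)" using eq by (simp add: equiv_def)
      then have "(sseq s i, sseq s i) \<in> iota_eq X"
        using sseq_in_inf_pts[OF X s i] by (rule refl_onD)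
      then show "(s, s) \<in> eps_rel X" using s by (simp add: iff)
    qed
    show "sym (eps_rel X)" using eq by (auto intro!: symI simp: iff equiv_def dest: symD)
    show "trans (eps_rel X)" using eq by (auto intro!: transI simp: iff equiv_def dest: transD)
  qed
qed

text \<open>The set under \<open>the_elem\<close> is a singleton: nonempty by reflexivity of
  \<open>eps_rel\<close>, and constant by \<open>eps_rel_imp_iota_rel\<close>.\<close>

lemma omega'_class:
  assumes X: "standard_space X" and s: "s \<in> coarse_seqs X" and i: "i \<in> inf_nat"
  shows "omega' mem smem star X (eps_rel X `` {s}) = iota_eq X `` {sseq s i}"
proof -
  have "iota_eq X `` {sseq t j} = iota_eq X `` {sseq s i}" if "t \<in> eps_rel X `` {s}" "j \<in> inf_nat" for t j
    using eps_rel_imp_iota_rel[OF X _ i that(2), of s t] that(1) equiv_class_eq[OF equiv_iota_rel[OF X]]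
    by auto
  moreover have "s \<in> eps_rel X `` {s}" using equiv_class_self[OF equiv_eps_rel[OF X] s] .
  ultimately have "{iota_eq X `` {sseq t j} | t j. t \<in> eps_rel X `` {s} \<and> j \<in> inf_nat} =
      {iota_eq X `` {sseq s i}}" using i by blast
  then show ?thesis unfolding omega'_def by simp
qed

section \<open>Functoriality and naturality\<close>

lemma star_fun_graph:
  assumes X: "standard_space X" and Y: "standard_space Y" and f: "pointed_coarse_map X Y f"
    and x: "x \<in> inf_pts mem smem star X"
  shows "(x, star_fun mem smem star (pts X) f x) \<in> srel ((\<lambda>a. (a, f a)) ` pts X)"
proof -
  have "f \<in> pts X \<rightarrow> pts Y" using f unfolding pointed_coarse_map_def by simp
  moreover have "x \<in> sset (pts X)" using x unfolding inf_pts_def by simp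
  ultimately show ?thesis
    using srel_graph[OF standard_spaceD(2)[OF X] standard_spaceD(2)[OF Y], of f x]
    unfolding star_fun_def by simp
qed

lemma is_rel_graph:
  assumes "standard_space X" "standard_space Y" "pointed_coarse_map X Y f"
  shows "is_rel ((\<lambda>a. (a, f a)) ` pts X)"
  by (rule is_relI[OF standard_spaceD(2)[OF assms(1)] standard_spaceD(2)[OF assms(2)]])
    (use assms(3) in \<open>auto simp: pointed_coarse_map_def\<close>)

text \<open>Conjugation by the graph of \<open>f\<close> takes far chains in \<open>X\<close> to far
  chains in \<open>Y\<close>: bornologousness supplies the controlled set of steps, properness the
  ball to avoid.\<close>

lemma star_fun_iota_rel:
  assumes X: "standard_space X" and Y: "standard_space Y" and f: "pointed_coarse_map X Y f"
    and xy: "(x, y) \<in> iota_eq X"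
  shows "(star_fun mem smem star (pts X) f x, star_fun mem smem star (pts X) f y) \<in> iota_eq Y"
proof -
  let ?f = "star_fun mem smem star (pts X) f" and ?G = "(\<lambda>a. (a, f a)) ` pts X"
  obtain E where E: "E \<in> ctrl X" "\<And>F. F \<in> ctrl X \<Longrightarrow> (x, y) \<in> srel (far_chains X E F)"
    using iota_relD[OF X xy] by blast
  have G: "is_rel ?G" by (rule is_rel_graph[OF X Y f])
  have "x \<in> inf_pts mem smem star X" "y \<in> inf_pts mem smem star X"
    using xy unfolding iota_rel_def by auto
  then have xG: "(x, ?f x) \<in> srel ?G" and yG: "(y, ?f y) \<in> srel ?G"
    using star_fun_graph[OF X Y f] by auto
  have "map_prod f f ` E \<in> ctrl Y"
    using f E(1) unfolding pointed_coarse_map_def bornologous_def by blast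
  then show ?thesis
  proof (rule iota_relI[OF Y])
    fix F assume "F \<in> ctrl Y"
    from far_chains_map[OF standard_spaceD(1)[OF X] standard_spaceD(1)[OF Y] f this]
    obtain H where H: "H \<in> ctrl X"
      "map_prod f f ` far_chains X E H \<subseteq> far_chains Y (map_prod f f ` E) F"
      by auto
    let ?R = "far_chains X E H"
    have R: "is_rel ?R" by (rule is_rel_far_chains[OF X])
    have "(?f x, ?f y) \<in> (srel ?G)\<inverse> O srel ?R O srel ?G"
      by (intro relcompI[OF converseI[OF xG]] relcompI[OF E(2)[OF H(1)]] yG)
    also have "\<dots> = srel (?G\<inverse> O ?R O ?G)"
      using R G by (simp add: srel_comp srel_converse is_rel_comp is_rel_converse)
    also have "\<dots> \<subseteq> srel (far_chains Y (map_prod f f ` E) F)"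
    proof (rule srel_mono[OF is_rel_far_chains[OF Y]])
      have "(f a, f b) \<in> far_chains Y (map_prod f f ` E) F" if "(a, b) \<in> ?R" for a b
        using H(2) map_prod_imageI[OF that, of f f] by (rule subsetD)
      then show "?G\<inverse> O ?R O ?G \<subseteq> far_chains Y (map_prod f f ` E) F" by auto
    qed
    finally show "(?f x, ?f y) \<in> srel (far_chains Y (map_prod f f ` E) F)" .
  qed
qed

text \<open>The composite of the graphs of \<open>s\<close> and \<open>f\<close> lies in the graph
  of \<open>f \<circ> s\<close>, whose star has only one value at \<open>i\<close>.\<close>

lemma sseq_compose:
  assumes X: "standard_space X" and Y: "standard_space Y" and f: "pointed_coarse_map X Y f"
    and s: "s \<in> coarse_seqs X" and i: "i \<in> inf_nat"
  shows "sseq (f \<circ> s) i = star_fun mem smem star (pts X) f (sseq s i)"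
proof -
  let ?G = "(\<lambda>a. (a, f a)) ` pts X"
  have fs: "f \<circ> s \<in> coarse_seqs Y" by (rule coarse_seqs_compose[OF s f standard_spaceD(1)[OF X]])
  note rs = range_coarse_seq[OF X s] and rfs = range_coarse_seq[OF Y fs]
  note A = standard_spaceD(2)[OF X] and B = standard_spaceD(2)[OF Y]
  have "(i, star_fun mem smem star (pts X) f (sseq s i)) \<in> srel (seq_graph s) O srel ?G"
    using sseq_graph[OF A rs i] star_fun_graph[OF X Y f sseq_in_inf_pts[OF X s i]] by blast
  also have "\<dots> = srel (seq_graph s O ?G)"
    using srel_comp[OF is_rel_seq_graph[OF A rs] is_rel_graph[OF X Y f]] by simp
  also have "\<dots> \<subseteq> srel (seq_graph (f \<circ> s))"
    by (rule srel_mono[OF is_rel_seq_graph[OF B rfs]]) (auto simp: seq_graph_def)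
  finally show ?thesis by (simp add: sseq_graph_iff[OF B rfs i])
qed

lemma (in -) the_elem_constant: "A \<noteq> {} \<Longrightarrow> (\<And>x. x \<in> A \<Longrightarrow> g x = c) \<Longrightarrow> the_elem (g ` A) = c"
  by (metis image_constant_conv image_cong the_elem_eq)

lemma iota_map_class:
  assumes X: "standard_space X" and Y: "standard_space Y" and f: "pointed_coarse_map X Y f"
    and x: "x \<in> inf_pts mem smem star X"
  shows "iota_map mem smem star X Y f (iota_eq X `` {x}) =
    iota_eq Y `` {star_fun mem smem star (pts X) f x}"
  unfolding iota_map_def
proof (rule the_elem_constant)
  show "iota_eq X `` {x} \<noteq> {}" using equiv_class_self[OF equiv_iota_rel[OF X] x] by blast
  fix y assume "y \<in> iota_eq X `` {x}"
  then have "(x, y) \<in> iota_eq X" by simp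
  from equiv_class_eq[OF equiv_iota_rel[OF Y] star_fun_iota_rel[OF X Y f this]]
  show "iota_eq Y `` {star_fun mem smem star (pts X) f y} =
    iota_eq Y `` {star_fun mem smem star (pts X) f x}" by simp
qed

text \<open>Independence of the representative comes from the extension: \<open>f \<circ> s\<close>
  and \<open>f \<circ> t\<close> are compared at an infinite index, and
  \<open>iota_rel_imp_eps_rel\<close> reflects the result back.\<close>

lemma eps_map_class:
  assumes X: "standard_space X" and Y: "standard_space Y" and f: "pointed_coarse_map X Y f"
    and s: "s \<in> coarse_seqs X"
  shows "eps_map X Y f (eps_rel X `` {s}) = eps_rel Y `` {f \<circ> s}"
  unfolding eps_map_def
proof (rule the_elem_constant)
  show "eps_rel X `` {s} \<noteq> {}" using equiv_class_self[OF equiv_eps_rel[OF X] s] by blast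
  fix t assume "t \<in> eps_rel X `` {s}"
  then have st: "(s, t) \<in> eps_rel X" by simp
  then have t: "t \<in> coarse_seqs X" unfolding eps_rel_def by simp
  obtain i where i: "i \<in> inf_nat" using infinite_nat_nonempty by blast
  have "(sseq (f \<circ> s) i, sseq (f \<circ> t) i) \<in> iota_eq Y"
    using star_fun_iota_rel[OF X Y f eps_rel_imp_iota_rel[OF X st i i]]
      sseq_compose[OF X Y f s i] sseq_compose[OF X Y f t i] by simp
  then have "(f \<circ> s, f \<circ> t) \<in> eps_rel Y"
    using iota_rel_imp_eps_rel[OF Y _ _ i i] coarse_seqs_compose[OF _ f standard_spaceD(1)[OF X]] s t
    by blast
  from equiv_class_eq[OF equiv_eps_rel[OF Y] this]
  show "eps_rel Y `` {f \<circ> t} = eps_rel Y `` {f \<circ> s}" by simp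
qed

lemma standard_category_space: "standard_category mem C \<Longrightarrow> X \<in> C \<Longrightarrow> standard_space X"
  unfolding standard_category_def standard_space_def is_set_def by blast

end

text \<open>\<open>the_elem\<close> is total, so well-definedness is not implied by the mere
  definition of \<open>omega'\<close>. The first four conjuncts express it, including the existence
  of infinite indices.\<close>

theorem theorem2p4:
  fixes mem :: "'u \<Rightarrow> 'u \<Rightarrow> bool"
    and smem :: "'v \<Rightarrow> 'v \<Rightarrow> bool"
    and star :: "'u \<Rightarrow> 'v"
    and C :: "'u pcoarse set"
    and X :: "'u pcoarse"
  assumes "nonstandard_universe mem smem star"
    and "standard_category mem C"
    and "X \<in> C"
  shows "infinite_nat mem smem star \<noteq> {} \<and>
    (\<forall>s\<in>coarse_seqs X. \<forall>i\<in>infinite_nat mem smem star.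
       star_seq mem smem star s i \<in> inf_pts mem smem star X) \<and>
    (\<forall>s t. (s, t) \<in> eps_rel X \<longrightarrow>
       (\<forall>i\<in>infinite_nat mem smem star. \<forall>j\<in>infinite_nat mem smem star.
          (star_seq mem smem star s i, star_seq mem smem star t j) \<in> iota_rel mem smem star X)) \<and>
    (\<forall>s\<in>coarse_seqs X. \<forall>i\<in>infinite_nat mem smem star.
       omega' mem smem star X (eps_rel X `` {s}) =
         iota_rel mem smem star X `` {star_seq mem smem star s i}) \<and>
    omega' mem smem star X \<in> eps X \<rightarrow> iota mem smem star X \<and>
    inj_on (omega' mem smem star X) (eps X) \<and>
    (\<forall>Y\<in>C. \<forall>f. pointed_coarse_map X Y f \<longrightarrow>
       (\<forall>k\<in>eps X. iota_map mem smem star X Y f (omega' mem smem star X k) =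
          omega' mem smem star Y (eps_map X Y f k)))"
proof -
  interpret nonstandard_universe mem smem star by (rule assms(1))
  have X: "standard_space X" using standard_category_space[OF assms(2,3)] .
  \<comment> \<open>One infinite index computes \<open>omega'\<close> on every class; injectivity
    and naturality are checked there.\<close>
  obtain i where i: "i \<in> inf_nat" using infinite_nat_nonempty by blast
  have omega: "omega' mem smem star X (eps_rel X `` {s}) = iota_eq X `` {sseq s i}"
    if "s \<in> coarse_seqs X" for s
    using omega'_class[OF X that i] .
  have maps: "omega' mem smem star X k \<in> iota mem smem star X" if "k \<in> eps X" for k
  proof -
    obtain s where s: "s \<in> coarse_seqs X" "k = eps_rel X `` {s}"
      using \<open>k \<in> eps X\<close> unfolding eps_def by (rule quotientE)
    show ?thesis
      unfolding s(2) omega[OF s(1)] iota_def by (rule quotientI[OF sseq_in_inf_pts[OF X s(1) i]])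
  qed
  have inj: "inj_on (omega' mem smem star X) (eps X)"
  proof (rule inj_onI)
    fix k l assume "k \<in> eps X" "l \<in> eps X" and eq: "omega' mem smem star X k = omega' mem smem star X l"
    then obtain s t where s: "s \<in> coarse_seqs X" "k = eps_rel X `` {s}"
      and t: "t \<in> coarse_seqs X" "l = eps_rel X `` {t}"
      unfolding eps_def by (meson quotientE)
    have "(sseq s i, sseq t i) \<in> iota_eq X"
      using eq unfolding s(2) t(2) omega[OF s(1)] omega[OF t(1)]
      by (rule eq_equiv_class[OF _ equiv_iota_rel[OF X] sseq_in_inf_pts[OF X t(1) i]])
    from equiv_class_eq[OF equiv_eps_rel[OF X] iota_rel_imp_eps_rel[OF X s(1) t(1) i i this]]
    show "k = l" unfolding s(2) t(2) .
  qed
  have natural: "iota_map mem smem star X Y f (omega' mem smem star X k) =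
      omega' mem smem star Y (eps_map X Y f k)"
    if Y: "Y \<in> C" and f: "pointed_coarse_map X Y f" and k: "k \<in> eps X" for Y f k
  proof -
    have Y: "standard_space Y" using standard_category_space[OF assms(2) Y] .
    obtain s where s: "s \<in> coarse_seqs X" "k = eps_rel X `` {s}"
      using k unfolding eps_def by (rule quotientE)
    have "f \<circ> s \<in> coarse_seqs Y" by (rule coarse_seqs_compose[OF s(1) f standard_spaceD(1)[OF X]])
    from omega'_class[OF Y this i] show ?thesis
      unfolding s(2) omega[OF s(1)] eps_map_class[OF X Y f s(1)]
        iota_map_class[OF X Y f sseq_in_inf_pts[OF X s(1) i]]
      by (simp add: sseq_compose[OF X Y f s(1) i])
  qed
  show ?thesis
    by (intro conjI ballI allI impI funcsetI infinite_nat_nonempty sseq_in_inf_pts[OF X]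
        eps_rel_imp_iota_rel[OF X] omega'_class[OF X] maps inj natural)
qed

end
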